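(* $\mathrm{Rel}(\textsc{Hamiltonian Cycle}, \mathrm{dist}_\Delta, 1)$ is in FP.
   Context: For a problem $\Pi$, a metric $\mathrm{dist}$ on its inputs, and a non-decreasing function $d:\mathbb N\to\mathbb R_+\cup\{\infty\}$, the function problem $\mathrm{Rel}(\Pi,\mathrm{dist},d)$ is: given an input $I$ of $\Pi$, output a pair $(J,\Pi(J))$ where $J$ is an input of $\Pi$ with $\mathrm{dist}(I,J)\le d(|I|)$ and $\Pi(J)$ is a correct answer to $\Pi$ on $J$ (a correct solution on $J$, or $\mathrm{nil}$ if none exists); the constant $1$ denotes the constant function. For graphs $G,H$: $\mathrm{dist}_\Delta(G,H)=\infty$ if $V(G)\neq V(H)$, and otherwise it is the maximum degree of the graph with vertex set $V(G)$ and edge set $E(G)\triangle E(H)$. \textsc{Hamiltonian Cycle}: given a graph $G$, output a Hamiltonian cycle of $G$, or $\mathrm{nil}$ if $G$ is not Hamiltonian. FP is the class of function problems solvable in polynomial time. *)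

theory Defs
  imports
    "HOL-Library.Extended_Nonnegative_Real"
    "HOL-Computational_Algebra.Polynomial"
begin

text \<open>
  Deterministic multi-tape Turing machines. States and tape symbols are initial segments of the
  natural numbers, all tapes are infinite in both directions, and symbol 0 is the blank.
  The bits False and True are the symbols 1 and 2. Tape 0 initially holds the input, tape 1 finally
  holds the output.
\<close>

datatype move = MoveLeft | MoveStay | MoveRight

record tm =
  num_tapes :: nat
  num_symbols :: nat
  num_states :: nat
  start_state :: nat
  final_state :: nat
  delta :: "nat \<Rightarrow> nat list \<Rightarrow> nat \<times> (nat \<times> move) list"

definition wf_tm :: "tm \<Rightarrow> bool" where
  "wf_tm M \<longleftrightarrow>
     num_tapes M \<ge> 2 \<and> num_symbols M \<ge> 3 \<and>
     start_state M < num_states M \<and> final_state M < num_states M \<and>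
     (\<forall>q < num_states M. \<forall>ss. length ss = num_tapes M \<and> set ss \<subseteq> {..<num_symbols M} \<longrightarrow>
        fst (delta M q ss) < num_states M \<and>
        length (snd (delta M q ss)) = num_tapes M \<and>
        (\<forall>(s, m) \<in> set (snd (delta M q ss)). s < num_symbols M))"

type_synonym tape = "(int \<Rightarrow> nat) \<times> int"
type_synonym config = "nat \<times> tape list"

fun tape_read :: "tape \<Rightarrow> nat" where
  "tape_read (f, i) = f i"

fun move_head :: "move \<Rightarrow> int \<Rightarrow> int" where
  "move_head MoveLeft i = i - 1"
| "move_head MoveStay i = i"
| "move_head MoveRight i = i + 1"

fun tape_act :: "nat \<times> move \<Rightarrow> tape \<Rightarrow> tape" where
  "tape_act (s, m) (f, i) = (f(i := s), move_head m i)"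

definition tm_step :: "tm \<Rightarrow> config \<Rightarrow> config" where
  "tm_step M c =
     (let (q, ts) = c in
      if q = final_state M then c
      else let (q', acts) = delta M q (map tape_read ts) in (q', map2 tape_act acts ts))"

definition bit_symbol :: "bool \<Rightarrow> nat" where
  "bit_symbol b = (if b then 2 else 1)"

definition tape_word :: "bool list \<Rightarrow> int \<Rightarrow> nat" where
  "tape_word w i = (if 0 \<le> i \<and> nat i < length w then bit_symbol (w ! nat i) else 0)"

definition tm_init :: "tm \<Rightarrow> bool list \<Rightarrow> config" where
  "tm_init M x =
     (start_state M, (tape_word x, 0) # replicate (num_tapes M - 1) (tape_word [], 0))"

definition tm_computes_within :: "tm \<Rightarrow> bool list \<Rightarrow> nat \<Rightarrow> bool list \<Rightarrow> bool" where
  "tm_computes_within M x t y \<longleftrightarrow>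
     (let (q, ts) = (tm_step M ^^ t) (tm_init M x)
      in q = final_state M \<and> fst (ts ! 1) = tape_word y)"

text \<open>
  A problem comes with bit-string encodings of its inputs and of its solutions; the size of an
  input is the length of its encoding. An answer is a solution, or None (nil) exactly when no
  solution exists.
\<close>

record ('i, 's) problem =
  inputs :: "'i set"
  solutions :: "'i \<Rightarrow> 's set"
  enc_input :: "'i \<Rightarrow> bool list"
  enc_solution :: "'s \<Rightarrow> bool list"

definition input_size :: "('i, 's) problem \<Rightarrow> 'i \<Rightarrow> nat" where
  "input_size P I = length (enc_input P I)"

definition answers :: "('i, 's) problem \<Rightarrow> 'i \<Rightarrow> 's option set" where
  "answers P I = (if solutions P I = {} then {None} else Some ` solutions P I)"

fun enc_option :: "('a \<Rightarrow> bool list) \<Rightarrow> 'a option \<Rightarrow> bool list" where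
  "enc_option e None = [False]"
| "enc_option e (Some a) = True # e a"

text \<open>
  In a pair, the bits of the first component are doubled, so that the first block of two different
  bits marks its end.
\<close>

fun enc_pair :: "('a \<Rightarrow> bool list) \<Rightarrow> ('b \<Rightarrow> bool list) \<Rightarrow> 'a \<times> 'b \<Rightarrow> bool list" where
  "enc_pair e e' (a, b) = concat (map (\<lambda>x. [x, x]) (e a)) @ [False, True] @ e' b"

definition FP :: "('i, 's) problem set" where
  "FP = {P. \<exists>M (p :: nat poly). wf_tm M \<and>
           (\<forall>I \<in> inputs P. \<exists>A \<in> answers P I.
              tm_computes_within M (enc_input P I) (poly p (input_size P I))
                (enc_option (enc_solution P) A))}"

definition Rel ::
  "('i, 's) problem \<Rightarrow> ('i \<Rightarrow> 'i \<Rightarrow> ennreal) \<Rightarrow> (nat \<Rightarrow> ennreal) \<Rightarrow> ('i, 'i \<times> 's option) problem"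
where
  "Rel P dst d =
     \<lparr> inputs = inputs P,
       solutions = (\<lambda>I. {(J, A). J \<in> inputs P \<and> dst I J \<le> d (input_size P I) \<and> A \<in> answers P J}),
       enc_input = enc_input P,
       enc_solution = enc_pair (enc_input P) (enc_option (enc_solution P)) \<rparr>"

record 'v graph =
  verts :: "'v set"
  edges :: "'v set set"

definition simple_graph :: "'v graph \<Rightarrow> bool" where
  "simple_graph G \<longleftrightarrow>
     finite (verts G) \<and> (\<forall>e \<in> edges G. e \<subseteq> verts G \<and> card e = 2)"

definition graph_degree :: "'v graph \<Rightarrow> 'v \<Rightarrow> nat" where
  "graph_degree G v = card {e \<in> edges G. v \<in> e}"

text \<open>The graph without vertices gets maximum degree 0.\<close>

definition max_degree :: "'v graph \<Rightarrow> nat" where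
  "max_degree G = Max (insert 0 (graph_degree G ` verts G))"

definition dist_Delta :: "'v graph \<Rightarrow> 'v graph \<Rightarrow> ennreal" where
  "dist_Delta G H =
     (if verts G \<noteq> verts H then \<infinity>
      else of_nat (max_degree
        \<lparr> verts = verts G, edges = (edges G - edges H) \<union> (edges H - edges G) \<rparr>))"

text \<open>A cycle is given by its vertices in cyclic order.\<close>

definition hamiltonian_cycle :: "'v graph \<Rightarrow> 'v list \<Rightarrow> bool" where
  "hamiltonian_cycle G c \<longleftrightarrow>
     length c \<ge> 3 \<and> distinct c \<and> set c = verts G \<and>
     (\<forall>i < length c. {c ! i, c ! (Suc i mod length c)} \<in> edges G)"

text \<open>
  Graphs are presented with vertex set \<open>{..<n}\<close>, by n in unary and the adjacency matrix row by row.
  Vertices of a cycle are written in unary, so that a cycle on n vertices has length at most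
  \<open>n\<^sup>2\<close>, no more than the adjacency matrix.
\<close>

definition input_graphs :: "nat graph set" where
  "input_graphs = {G. simple_graph G \<and> (\<exists>n. verts G = {..<n})}"

definition enc_unary :: "nat \<Rightarrow> bool list" where
  "enc_unary n = replicate n True @ [False]"

definition enc_graph :: "nat graph \<Rightarrow> bool list" where
  "enc_graph G =
     (let n = card (verts G)
      in enc_unary n @ concat (map (\<lambda>i. map (\<lambda>j. {i, j} \<in> edges G) [0..<n]) [0..<n]))"

definition enc_cycle :: "nat list \<Rightarrow> bool list" where
  "enc_cycle c = concat (map enc_unary c)"

definition Hamiltonian_Cycle :: "(nat graph, nat list) problem" where
  "Hamiltonian_Cycle =
     \<lparr> inputs = input_graphs,
       solutions = (\<lambda>G. {c. hamiltonian_cycle G c}),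
       enc_input = enc_graph,
       enc_solution = enc_cycle \<rparr>"

end

theory Submission
  imports Defs
begin

text \<open>
  Look for a permutation \<open>\<pi>\<close> of the vertices that moves every vertex along an edge. A Hamiltonian cycle
  of G gives one, so if there is none, the graph G itself with answer nil is a correct output.
  Otherwise, with at least three vertices, link the cycles of \<open>\<pi>\<close> cyclically: leave every cycle at the
  predecessor of the vertex where it was entered, and go to the entry of the next cycle. Every cycle of
  \<open>\<pi>\<close> has at least two vertices, so its entry differs from its exit, and the added edges form a
  matching; they make G Hamiltonian.

  The permutation is found by an auction: an unassigned vertex takes its cheapest neighbour from the
  present owner and raises the price by one; it gives up if all its neighbours have price n.

  The running time is handled once and for all by a language whose only loops run over all vertices.
\<close>

section \<open>Structured programs for Turing machines\<close>

text \<open>Distance 1 means that only a matching may be changed. A permutation along edges is the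
  right relaxation because its cycles may have length two and then run along one edge back and
  forth: it is a perfect matching in the bipartite double cover of G, and no matching theory of
  general graphs is needed. Injectivity and the absence of fixed points are all that makes the
  linking edges disjoint.

  The auction replaces a search for augmenting paths. A bid is a scan for a cheapest neighbour, and
  its invariant only compares prices of neighbours. Each bid that changes anything raises the sum of
  the prices, which never exceeds n * n, so the number of rounds can be fixed in advance. This suits
  a language without unbounded loops: a search that has succeeded keeps running, and a flag makes
  the rest of it idle.

  The language has no arithmetic either. Prices are kept in unary as rows of bits, the order of the
  vertices is computed as a matrix, and a chain of three indices shows that n is at least 3. The
  size is tested separately because a single edge on two vertices has such a permutation but no
  Hamiltonian cycle.\<close>

datatype prog =
    Put nat nat
  | Mv nat move
  | Seq prog prog  (infixr \<open>;;\<close> 60)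
  | Cond nat "nat \<Rightarrow> bool" prog prog
  | Loop nat "nat \<Rightarrow> bool" prog

text \<open>The step counts are exactly those of the machine: \<open>Put\<close>, \<open>Mv\<close>
  and every test take one step, and sequencing takes none, since the code of the first program
  leaves directly to the entry of the second.\<close>

inductive exec :: "prog \<Rightarrow> (nat \<Rightarrow> tape) \<Rightarrow> nat \<Rightarrow> (nat \<Rightarrow> tape) \<Rightarrow> bool" where
  exec_Put: "exec (Put k s) \<sigma> 1 (\<sigma>(k := tape_act (s, MoveStay) (\<sigma> k)))"
| exec_Mv: "exec (Mv k m) \<sigma> 1 (\<sigma>(k := tape_act (tape_read (\<sigma> k), m) (\<sigma> k)))"
| exec_Seq: "exec p \<sigma> t \<sigma>' \<Longrightarrow> exec q \<sigma>' t' \<sigma>'' \<Longrightarrow> exec (p ;; q) \<sigma> (t + t') \<sigma>''"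
| exec_Cond_True: "P (tape_read (\<sigma> k)) \<Longrightarrow> exec p \<sigma> t \<sigma>' \<Longrightarrow> exec (Cond k P p q) \<sigma> (Suc t) \<sigma>'"
| exec_Cond_False: "\<not> P (tape_read (\<sigma> k)) \<Longrightarrow> exec q \<sigma> t \<sigma>' \<Longrightarrow> exec (Cond k P p q) \<sigma> (Suc t) \<sigma>'"
| exec_Loop_False: "\<not> P (tape_read (\<sigma> k)) \<Longrightarrow> exec (Loop k P p) \<sigma> 1 \<sigma>"
| exec_Loop_True: "P (tape_read (\<sigma> k)) \<Longrightarrow> exec p \<sigma> t \<sigma>' \<Longrightarrow> exec (Loop k P p) \<sigma>' t' \<sigma>'' \<Longrightarrow>
    exec (Loop k P p) \<sigma> (Suc (t + t')) \<sigma>''"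

primrec psize :: "prog \<Rightarrow> nat" where
  "psize (Put k s) = 1"
| "psize (Mv k m) = 1"
| "psize (p ;; q) = psize p + psize q"
| "psize (Cond k P p q) = Suc (psize p + psize q)"
| "psize (Loop k P p) = Suc (psize p)"

primrec uses_within :: "nat \<Rightarrow> nat \<Rightarrow> prog \<Rightarrow> bool" where
  "uses_within K S (Put k s) \<longleftrightarrow> k < K \<and> s < S"
| "uses_within K S (Mv k m) \<longleftrightarrow> k < K"
| "uses_within K S (p ;; q) \<longleftrightarrow> uses_within K S p \<and> uses_within K S q"
| "uses_within K S (Cond k P p q) \<longleftrightarrow> k < K \<and> uses_within K S p \<and> uses_within K S q"
| "uses_within K S (Loop k P p) \<longleftrightarrow> k < K \<and> uses_within K S p"

section \<open>Translation of structured programs to transition functions\<close>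

definition stay :: "nat \<Rightarrow> nat list \<Rightarrow> (nat \<times> move) list" where
  "stay K ss = map (\<lambda>i. (ss ! i, MoveStay)) [0..<K]"

text \<open>
  The code of a program occupies the states from \<open>b\<close> on, is entered at \<open>b\<close> and is left to \<open>e\<close>.
\<close>

primrec code :: "nat \<Rightarrow> prog \<Rightarrow> nat \<Rightarrow> nat \<Rightarrow> nat \<Rightarrow> nat list \<Rightarrow> nat \<times> (nat \<times> move) list" where
  "code K (Put k s) b e q ss = (e, (stay K ss)[k := (s, MoveStay)])"
| "code K (Mv k m) b e q ss = (e, (stay K ss)[k := (ss ! k, m)])"
| "code K (p ;; p') b e q ss =
     (if q < b + psize p then code K p b (b + psize p) q ss else code K p' (b + psize p) e q ss)"
| "code K (Cond k P p p') b e q ss =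
     (if q = b then (if P (ss ! k) then Suc b else Suc b + psize p, stay K ss)
      else if q < Suc b + psize p then code K p (Suc b) e q ss
      else code K p' (Suc b + psize p) e q ss)"
| "code K (Loop k P p) b e q ss =
     (if q = b then (if P (ss ! k) then Suc b else e, stay K ss) else code K p (Suc b) b q ss)"

lemma psize_pos [simp]: "0 < psize p"
  by (induction p) auto

lemma length_stay [simp]: "length (stay K ss) = K"
  by (simp add: stay_def)

lemma nth_stay [simp]: "i < K \<Longrightarrow> stay K ss ! i = (ss ! i, MoveStay)"
  by (simp add: stay_def)

lemma tape_act_stay [simp]: "tape_act (tape_read t, MoveStay) t = t"
  by (cases t) auto

lemma map2_tape_act_stay:
  "map2 tape_act (stay K (map tape_read (map \<sigma> [0..<K]))) (map \<sigma> [0..<K]) = map \<sigma> [0..<K]"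
  by (intro nth_equalityI) auto

lemma map2_tape_act_update:
  "k < K \<Longrightarrow> map2 tape_act ((stay K (map tape_read (map \<sigma> [0..<K])))[k := a]) (map \<sigma> [0..<K])
    = map (\<sigma>(k := tape_act a (\<sigma> k))) [0..<K]"
  by (intro nth_equalityI) (auto simp: nth_list_update)

text \<open>Only the states of one block are constrained, so the predicate passes to the blocks of
  subprograms within a single machine. The block has to avoid the final state, where
  \<open>tm_step\<close> stands still.\<close>

definition runs_code :: "tm \<Rightarrow> prog \<Rightarrow> nat \<Rightarrow> nat \<Rightarrow> bool" where
  "runs_code M p b e \<longleftrightarrow>
     (\<forall>q \<in> {b..<b + psize p}. q \<noteq> final_state M \<and> delta M q = code (num_tapes M) p b e q)"

lemma tm_step_code:
  assumes "runs_code M p b e"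
    and "code (num_tapes M) p b e b (map tape_read ts) = (q', acts)"
  shows "tm_step M (b, ts) = (q', map2 tape_act acts ts)"
  using assms psize_pos[of p] unfolding tm_step_def runs_code_def by (auto simp del: psize_pos)

lemma exec_code:
  assumes "exec p \<sigma> t \<sigma>'" "uses_within K S p" "num_tapes M = K" "runs_code M p b e"
  shows "(tm_step M ^^ t) (b, map \<sigma> [0..<K]) = (e, map \<sigma>' [0..<K])"
  using assms
proof (induction arbitrary: b e rule: exec.induct)
  case (exec_Put k s \<sigma>)
  then have "tm_step M (b, map \<sigma> [0..<K]) =
      (e, map2 tape_act ((stay K (map tape_read (map \<sigma> [0..<K])))[k := (s, MoveStay)]) (map \<sigma> [0..<K]))"
    by (intro tm_step_code) auto
  then show ?case using exec_Put map2_tape_act_update[of k K \<sigma> "(s, MoveStay)"] by simp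
next
  case (exec_Mv k m \<sigma>)
  then have "tm_step M (b, map \<sigma> [0..<K]) =
      (e, map2 tape_act ((stay K (map tape_read (map \<sigma> [0..<K])))[k := (tape_read (\<sigma> k), m)]) (map \<sigma> [0..<K]))"
    by (intro tm_step_code) auto
  then show ?case using exec_Mv map2_tape_act_update[of k K \<sigma>] by simp
next
  case (exec_Seq p \<sigma> t \<sigma>' q t' \<sigma>'')
  have 1: "runs_code M p b (b + psize p)" and 2: "runs_code M q (b + psize p) e"
    using exec_Seq.prems by (auto simp: runs_code_def)
  have "(tm_step M ^^ (t + t')) (b, map \<sigma> [0..<K]) = (tm_step M ^^ t') ((tm_step M ^^ t) (b, map \<sigma> [0..<K]))"
    by (subst add.commute) (simp add: funpow_add)
  also have "\<dots> = (e, map \<sigma>'' [0..<K])"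
    using exec_Seq.IH(1)[OF _ _ 1] exec_Seq.IH(2)[OF _ _ 2] exec_Seq.prems by simp
  finally show ?case .
next
  case (exec_Cond_True P \<sigma> k p t \<sigma>' q)
  have 1: "runs_code M p (Suc b) e"
    using exec_Cond_True.prems by (auto simp: runs_code_def)
  have "tm_step M (b, map \<sigma> [0..<K]) =
      (Suc b, map2 tape_act (stay K (map tape_read (map \<sigma> [0..<K]))) (map \<sigma> [0..<K]))"
    by (rule tm_step_code) (use exec_Cond_True in auto)
  then show ?case using exec_Cond_True.IH[OF _ _ 1] exec_Cond_True.prems
    by (simp add: funpow_swap1 map2_tape_act_stay del: map_map)
next
  case (exec_Cond_False P \<sigma> k q t \<sigma>' p)
  have 1: "runs_code M q (Suc b + psize p) e"
    using exec_Cond_False.prems by (auto simp: runs_code_def)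
  have "tm_step M (b, map \<sigma> [0..<K]) =
      (Suc b + psize p, map2 tape_act (stay K (map tape_read (map \<sigma> [0..<K]))) (map \<sigma> [0..<K]))"
    by (rule tm_step_code) (use exec_Cond_False in auto)
  then show ?case using exec_Cond_False.IH[OF _ _ 1] exec_Cond_False.prems
    by (simp add: funpow_swap1 map2_tape_act_stay del: map_map)
next
  case (exec_Loop_False P \<sigma> k p)
  have "tm_step M (b, map \<sigma> [0..<K]) =
      (e, map2 tape_act (stay K (map tape_read (map \<sigma> [0..<K]))) (map \<sigma> [0..<K]))"
    by (rule tm_step_code) (use exec_Loop_False in auto)
  then show ?case by (simp add: map2_tape_act_stay del: map_map)
next
  case (exec_Loop_True P \<sigma> k p t \<sigma>' t' \<sigma>'')
  \<comment> \<open>The body is left to the test of the loop itself, so the remaining rounds start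
    again at \<open>b\<close>.\<close>
  have 1: "runs_code M p (Suc b) b"
    using exec_Loop_True.prems by (auto simp: runs_code_def)
  have "tm_step M (b, map \<sigma> [0..<K]) =
      (Suc b, map2 tape_act (stay K (map tape_read (map \<sigma> [0..<K]))) (map \<sigma> [0..<K]))"
    by (rule tm_step_code) (use exec_Loop_True in auto)
  then have "(tm_step M ^^ Suc (t + t')) (b, map \<sigma> [0..<K]) = (tm_step M ^^ (t' + t)) (Suc b, map \<sigma> [0..<K])"
    by (simp add: funpow_swap1 map2_tape_act_stay add.commute del: map_map)
  also have "\<dots> = (tm_step M ^^ t') (b, map \<sigma>' [0..<K])"
    using exec_Loop_True.IH(1)[OF _ _ 1] exec_Loop_True.prems by (simp add: funpow_add)
  also have "\<dots> = (e, map \<sigma>'' [0..<K])"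
    using exec_Loop_True.IH(2) exec_Loop_True.prems by simp
  finally show ?case .
qed

definition machine :: "nat \<Rightarrow> nat \<Rightarrow> prog \<Rightarrow> tm" where
  "machine K S p =
     \<lparr> num_tapes = K, num_symbols = S, num_states = Suc (psize p), start_state = 0,
       final_state = psize p, delta = code K p 0 (psize p) \<rparr>"

text \<open>With \<open>b = 0\<close> and \<open>e = psize p\<close> this keeps the machine among
  its states. The state \<open>q\<close> is arbitrary, because well-formedness also quantifies over
  the final state, which lies outside the code.\<close>

lemma fst_code: "fst (code K p b e q ss) < b + psize p \<or> fst (code K p b e q ss) = e"
proof (induction p arbitrary: b e)
  case (Seq p1 p2)
  show ?case
    using Seq.IH(1)[of b "b + psize p1"] Seq.IH(2)[of "b + psize p1" e] psize_pos[of p2]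
    by (auto simp del: psize_pos)
next
  case (Cond k P p1 p2)
  show ?case
    using Cond.IH(1)[of "Suc b" e] Cond.IH(2)[of "Suc (b + psize p1)" e] psize_pos[of p2] psize_pos[of p1]
    by (auto simp del: psize_pos)
next
  case (Loop k P p)
  show ?case using Loop.IH[of "Suc b" b] by auto
qed auto

lemma snd_code:
  assumes "uses_within K S p" "length ss = K" "set ss \<subseteq> {..<S}"
  shows "length (snd (code K p b e q ss)) = K \<and> (\<forall>(s, m) \<in> set (snd (code K p b e q ss)). s < S)"
proof -
  have nth: "ss ! i < S" if "i < K" for i
    using assms(2,3) that nth_mem by blast
  then have stay: "\<forall>(s, m) \<in> set (stay K ss). s < S"
    by (auto simp: stay_def)
  show ?thesis using assms(1)
  proof (induction p arbitrary: b e)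
    case (Put k s)
    then show ?case using stay set_update_subset_insert[of "stay K ss"] by fastforce
  next
    case (Mv k m)
    then show ?case using stay nth[of k] set_update_subset_insert[of "stay K ss" k "(ss ! k, m)"] by fastforce
  qed (use stay in auto)
qed

lemma wf_machine: "2 \<le> K \<Longrightarrow> 3 \<le> S \<Longrightarrow> uses_within K S p \<Longrightarrow> wf_tm (machine K S p)"
  unfolding wf_tm_def
  using fst_code[of K p 0 "psize p"] snd_code[of K S p _ 0 "psize p"]
  by (simp add: machine_def less_Suc_eq) metis

text \<open>\<open>tm_computes_within\<close> asks for the configuration after exactly
  \<open>t\<close> steps. As the final state is absorbing, a run that ends early may be padded to
  any larger time.\<close>

lemma tm_step_final: "(tm_step M ^^ t) (final_state M, ts) = (final_state M, ts)"
  by (induction t) (auto simp: tm_step_def)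

definition init_tapes :: "bool list \<Rightarrow> nat \<Rightarrow> tape" where
  "init_tapes x k = (tape_word (if k = 0 then x else []), 0)"

lemma machine_computes:
  assumes "exec p (init_tapes x) t \<sigma>'" "uses_within K S p" "2 \<le> K" "t \<le> T" "fst (\<sigma>' 1) = tape_word y"
  shows "tm_computes_within (machine K S p) x T y"
proof -
  let ?M = "machine K S p"
  have "tm_init ?M x = (0, map (init_tapes x) [0..<K])"
    using assms(3) by (auto simp: tm_init_def machine_def init_tapes_def nth_Cons' intro!: nth_equalityI)
  moreover have "(tm_step ?M ^^ t) (0, map (init_tapes x) [0..<K]) = (psize p, map \<sigma>' [0..<K])"
    by (rule exec_code[OF assms(1,2)]) (auto simp: machine_def runs_code_def)
  moreover have "(tm_step ?M ^^ T) c = (tm_step ?M ^^ (T - t)) ((tm_step ?M ^^ t) c)" for c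
    using assms(4) by (simp flip: funpow_add[THEN fun_cong, unfolded o_apply])
  ultimately have "(tm_step ?M ^^ T) (tm_init ?M x) = (psize p, map \<sigma>' [0..<K])"
    using tm_step_final[where M = ?M] by (simp add: machine_def)
  then show ?thesis
    using assms(3,5) by (simp add: tm_computes_within_def machine_def)
qed

section \<open>Rules for upper bounds on the running time\<close>

definition runs :: "prog \<Rightarrow> (nat \<Rightarrow> tape) \<Rightarrow> nat \<Rightarrow> (nat \<Rightarrow> tape) \<Rightarrow> bool" where
  "runs p \<sigma> T \<sigma>' \<longleftrightarrow> (\<exists>t \<le> T. exec p \<sigma> t \<sigma>')"

lemma runs_mono: "runs p \<sigma> T \<sigma>' \<Longrightarrow> T \<le> T' \<Longrightarrow> runs p \<sigma> T' \<sigma>'"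
  unfolding runs_def by (meson le_trans)

lemma runs_Put: "\<sigma> k = (f, i) \<Longrightarrow> runs (Put k s) \<sigma> 1 (\<sigma>(k := (f(i := s), i)))"
  using exec_Put[of k s \<sigma>] unfolding runs_def by auto

lemma runs_Mv: "\<sigma> k = (f, i) \<Longrightarrow> runs (Mv k m) \<sigma> 1 (\<sigma>(k := (f, move_head m i)))"
  using exec_Mv[of k m \<sigma>] unfolding runs_def by auto

lemma runs_Seq: "runs p \<sigma> T \<sigma>' \<Longrightarrow> runs q \<sigma>' T' \<sigma>'' \<Longrightarrow> runs (p ;; q) \<sigma> (T + T') \<sigma>''"
  unfolding runs_def using exec_Seq add_mono by blast

lemma runs_Cond_True: "P (tape_read (\<sigma> k)) \<Longrightarrow> runs p \<sigma> T \<sigma>' \<Longrightarrow> runs (Cond k P p q) \<sigma> (Suc T) \<sigma>'"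
  unfolding runs_def using exec_Cond_True by (meson Suc_le_mono)

lemma runs_Cond_False: "\<not> P (tape_read (\<sigma> k)) \<Longrightarrow> runs q \<sigma> T \<sigma>' \<Longrightarrow> runs (Cond k P p q) \<sigma> (Suc T) \<sigma>'"
  unfolding runs_def using exec_Cond_False by (meson Suc_le_mono)

text \<open>Every round pays one step for the test besides its body, and the failing test at the end
  costs one more. The invariant is a predicate, since the tapes after a round may be known only up
  to existence.\<close>

lemma runs_Loop_inv:
  assumes "\<And>i \<sigma>. i < m \<Longrightarrow> I i \<sigma> \<Longrightarrow> P (tape_read (\<sigma> k)) \<and> (\<exists>\<sigma>'. runs p \<sigma> T \<sigma>' \<and> I (Suc i) \<sigma>')"
    and "\<And>\<sigma>. I m \<sigma> \<Longrightarrow> \<not> P (tape_read (\<sigma> k))" and "I 0 \<sigma>"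
  shows "\<exists>\<sigma>'. runs (Loop k P p) \<sigma> (m * Suc T + 1) \<sigma>' \<and> I m \<sigma>'"
  using assms
proof (induction m arbitrary: I \<sigma>)
  case 0
  then show ?case using exec_Loop_False[of P \<sigma> k p] unfolding runs_def by auto
next
  case (Suc m)
  obtain \<sigma>1 where 1: "P (tape_read (\<sigma> k))" "runs p \<sigma> T \<sigma>1" "I 1 \<sigma>1"
    using Suc.prems(1)[of 0 \<sigma>] Suc.prems(3) by auto
  have "\<exists>\<sigma>'. runs (Loop k P p) \<sigma>1 (m * Suc T + 1) \<sigma>' \<and> I (Suc m) \<sigma>'"
    by (rule Suc.IH[of "\<lambda>i. I (Suc i)"]) (use Suc.prems 1 in auto)
  then obtain \<sigma>' where 2: "runs (Loop k P p) \<sigma>1 (m * Suc T + 1) \<sigma>'" "I (Suc m) \<sigma>'" by blast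
  obtain t t' where "t \<le> T" "exec p \<sigma> t \<sigma>1" "t' \<le> m * Suc T + 1" "exec (Loop k P p) \<sigma>1 t' \<sigma>'"
    using 1 2 unfolding runs_def by blast
  then have "exec (Loop k P p) \<sigma> (Suc (t + t')) \<sigma>'" "Suc (t + t') \<le> Suc m * Suc T + 1"
    using 1(1) exec_Loop_True by auto
  then show ?case using 2(2) unfolding runs_def by blast
qed

lemma runs_Loop:
  assumes "\<And>i. i < m \<Longrightarrow> P (tape_read (S i k)) \<and> runs p (S i) T (S (Suc i))"
    and "\<not> P (tape_read (S m k))"
  shows "runs (Loop k P p) (S 0) (m * Suc T + 1) (S m)"
  using runs_Loop_inv[of m "\<lambda>i \<sigma>. \<sigma> = S i" P k p T "S 0"] assms by blast

section \<open>Bounded loops over square arrays\<close>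

datatype cmd =
    Nop
  | Then cmd cmd  (infixr \<open>;\<close> 60)
  | Write nat nat nat nat
  | If nat nat nat nat cmd cmd
  | For nat cmd
  | Out bool

type_synonym store = "nat \<times> nat \<times> nat \<Rightarrow> nat"

text \<open>A \<open>For\<close> always makes all n rounds and cannot be left early; searches must
  therefore be guarded by a flag. Only \<open>For\<close> changes an index, so no arithmetic on
  indices is available.\<close>

primrec run :: "nat \<Rightarrow> cmd \<Rightarrow> (nat \<Rightarrow> nat) \<Rightarrow> store \<times> bool list \<Rightarrow> store \<times> bool list" where
  "run n Nop \<rho> s = s"
| "run n (c ; c') \<rho> s = run n c' \<rho> (run n c \<rho> s)"
| "run n (Write a u v x) \<rho> s = ((fst s)((a, \<rho> u, \<rho> v) := x), snd s)"
| "run n (If a u v x c c') \<rho> s = (if fst s (a, \<rho> u, \<rho> v) = x then run n c \<rho> s else run n c' \<rho> s)"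
| "run n (For u c) \<rho> s = fold (\<lambda>i. run n c (\<rho>(u := i))) [0..<n] s"
| "run n (Out b) \<rho> s = (fst s, snd s @ [b])"

text \<open>
  Tapes 0 and 2 to 10 hold arrays, tape 1 holds the output, tape 11 counts columns when a row is
  skipped, and the remaining tapes hold loop indices.
\<close>

definition arrays :: "nat set" where
  "arrays = insert 0 {2..<11}"

abbreviation (input) counter :: nat where
  "counter \<equiv> 11"

abbreviation (input) ntapes :: nat where
  "ntapes \<equiv> 20"

abbreviation (input) nsymbols :: nat where
  "nsymbols \<equiv> 4"

definition indices :: "nat set" where
  "indices = {12..<ntapes}"

primrec loop_vars :: "cmd \<Rightarrow> nat set" where
  "loop_vars Nop = {}"
| "loop_vars (c ; c') = loop_vars c \<union> loop_vars c'"
| "loop_vars (Write a u v x) = {}"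
| "loop_vars (If a u v x c c') = loop_vars c \<union> loop_vars c'"
| "loop_vars (For u c) = insert u (loop_vars c)"
| "loop_vars (Out b) = {}"

text \<open>Symbol 3 is reserved for markers, hence \<open>x < 3\<close>. An inner loop may not
  reuse the index of an enclosing one, because the index is a head position, which the inner loop
  would reset.\<close>

primrec wf_cmd :: "cmd \<Rightarrow> bool" where
  "wf_cmd Nop \<longleftrightarrow> True"
| "wf_cmd (c ; c') \<longleftrightarrow> wf_cmd c \<and> wf_cmd c'"
| "wf_cmd (Write a u v x) \<longleftrightarrow> a \<in> arrays \<and> u \<in> indices \<and> v \<in> indices \<and> x < 3"
| "wf_cmd (If a u v x c c') \<longleftrightarrow>
     a \<in> arrays \<and> u \<in> indices \<and> v \<in> indices \<and> x < 3 \<and> wf_cmd c \<and> wf_cmd c'"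
| "wf_cmd (For u c) \<longleftrightarrow> u \<in> indices \<and> u \<notin> loop_vars c \<and> wf_cmd c"
| "wf_cmd (Out b) \<longleftrightarrow> True"

definition rewind :: "nat \<Rightarrow> prog" where
  "rewind r = Loop r (\<lambda>x. x \<noteq> 3) (Mv r MoveLeft) ;; Mv r MoveRight"

text \<open>
  An index is the head position on a tape with marker 3 at -1 and symbol 1 at the positions below n.
  Marking that position by symbol 2 allows to count up to it and so to restore it.
\<close>

definition iterate :: "nat \<Rightarrow> prog \<Rightarrow> prog" where
  "iterate r p =
     Put r 2 ;; rewind r ;; Loop r (\<lambda>x. x \<noteq> 2) (p ;; Mv r MoveRight) ;; Put r 1"

definition skip_row :: "nat \<Rightarrow> prog" where
  "skip_row a =
     Loop counter (\<lambda>x. x = 1) (Mv a MoveRight ;; Mv counter MoveRight) ;; rewind counter"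

text \<open>Arrays are stored row by row to the right of a marker: one move past the marker, then a
  whole row for each unit of \<open>u\<close>, then single cells for \<open>v\<close>. Since
  \<open>iterate\<close> restores its index, \<open>u\<close> and \<open>v\<close> may
  coincide.\<close>

definition seek :: "nat \<Rightarrow> nat \<Rightarrow> nat \<Rightarrow> prog" where
  "seek a u v = Mv a MoveRight ;; iterate u (skip_row a) ;; iterate v (Mv a MoveRight)"

definition go_home :: "nat \<Rightarrow> prog" where
  "go_home a = Loop a (\<lambda>x. x \<noteq> 3) (Mv a MoveLeft)"

primrec compile :: "cmd \<Rightarrow> prog" where
  "compile Nop = Mv 1 MoveStay"
| "compile (c ; c') = compile c ;; compile c'"
| "compile (Write a u v x) = seek a u v ;; Put a x ;; go_home a"
| "compile (If a u v x c c') =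
     seek a u v ;; Cond a (\<lambda>y. y = x) (go_home a ;; compile c) (go_home a ;; compile c')"
| "compile (For u c) = Loop u (\<lambda>x. x = 1) (compile c ;; Mv u MoveRight) ;; rewind u"
| "compile (Out b) = Put 1 (bit_symbol b) ;; Mv 1 MoveRight"

text \<open>A generous bound for seeking, one operation on the cell, and the way back to the marker,
  which together take at most 7 * n^2 + 14 * n + 19 steps.\<close>

abbreviation (input) access_time :: "nat poly" where
  "access_time \<equiv> [:40, 20, 10:]"

text \<open>Both branches of an \<open>If\<close> are charged. In a \<open>For\<close>, the added 2
  pays for the test and the move of the index in each round; the linear remainder pays for the last
  test and the rewinding.\<close>

primrec time :: "cmd \<Rightarrow> nat poly" where
  "time Nop = 1"
| "time (c ; c') = time c + time c'"
| "time (Write a u v x) = access_time"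
| "time (If a u v x c c') = access_time + time c + time c'"
| "time (For u c) = [:0, 1:] * (time c + 2) + [:10, 4:]"
| "time (Out b) = 2"

section \<open>Memory layout and correctness of the compiler\<close>

definition index_tape :: "nat \<Rightarrow> int \<Rightarrow> nat" where
  "index_tape n i = (if i = -1 then 3 else if 0 \<le> i \<and> i < int n then 1 else 0)"

text \<open>The marker stands at an arbitrary position \<open>h\<close> because array 0 stays where
  the input has it, behind the unary number. Symbols below 3 to the right of \<open>h\<close> ensure
  that a walk to the left stops at \<open>h\<close> and not before.\<close>

definition array_tape :: "nat \<Rightarrow> (nat \<times> nat \<Rightarrow> nat) \<Rightarrow> tape \<Rightarrow> bool" where
  "array_tape n g t \<longleftrightarrow> (case t of (f, h) \<Rightarrow> f h = 3 \<and> (\<forall>i > h. f i < 3) \<and>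
     (\<forall>u < n. \<forall>v < n. f (h + 1 + int (u * n + v)) = g (u, v)))"

text \<open>The state between two commands: array heads rest on their markers, the output head
  stands behind the output, and an index is nothing but a head position.\<close>

definition represents ::
  "nat \<Rightarrow> (nat \<Rightarrow> nat) \<Rightarrow> store \<times> bool list \<Rightarrow> (nat \<Rightarrow> tape) \<Rightarrow> bool"
where
  "represents n \<rho> s \<sigma> \<longleftrightarrow>
     \<sigma> 1 = (tape_word (snd s), int (length (snd s))) \<and>
     (\<forall>a \<in> arrays. array_tape n (\<lambda>uv. fst s (a, uv)) (\<sigma> a)) \<and>
     \<sigma> counter = (index_tape n, 0) \<and>
     (\<forall>u \<in> indices. \<rho> u < n \<and> \<sigma> u = (index_tape n, int (\<rho> u)))"

lemma runs_rewind:
  assumes "\<sigma> r = (f, int v)" "f (-1) = 3" "\<forall>i. 0 \<le> i \<and> i \<le> int v \<longrightarrow> f i \<noteq> 3" "v \<le> n"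
  shows "runs (rewind r) \<sigma> (2 * n + 4) (\<sigma>(r := (f, 0)))"
proof -
  let ?S = "\<lambda>i. \<sigma>(r := (f, int v - int i))"
  have "runs (Loop r (\<lambda>x. x \<noteq> 3) (Mv r MoveLeft)) (?S 0) (Suc v * Suc 1 + 1) (?S (Suc v))"
  proof (rule runs_Loop)
    fix i assume "i < Suc v"
    then show "tape_read (?S i r) \<noteq> 3 \<and> runs (Mv r MoveLeft) (?S i) 1 (?S (Suc i))"
      using assms(3) runs_Mv[of "?S i" r f "int v - int i" MoveLeft] by (simp add: algebra_simps)
  qed (use assms in simp)
  moreover have "?S 0 = \<sigma>" using assms(1) by (auto simp: fun_eq_iff)
  moreover have "runs (Mv r MoveRight) (?S (Suc v)) 1 (\<sigma>(r := (f, 0)))"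
    using runs_Mv[of "?S (Suc v)" r f "-1" MoveRight] by simp
  ultimately have "runs (rewind r) \<sigma> (Suc v * Suc 1 + 1 + 1) (\<sigma>(r := (f, 0)))"
    unfolding rewind_def by (metis runs_Seq)
  then show ?thesis by (rule runs_mono) (use assms(4) in auto)
qed

lemma runs_rewind_index:
  "\<sigma> r = (index_tape n, int v) \<Longrightarrow> v \<le> n \<Longrightarrow>
    runs (rewind r) \<sigma> (2 * n + 4) (\<sigma>(r := (index_tape n, 0)))"
  by (rule runs_rewind) (auto simp: index_tape_def)

definition shift :: "nat \<Rightarrow> nat \<Rightarrow> (nat \<Rightarrow> tape) \<Rightarrow> nat \<Rightarrow> tape" where
  "shift a d \<sigma> = \<sigma>(a := (fst (\<sigma> a), snd (\<sigma> a) + int d))"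

lemma shift_0 [simp]: "shift a 0 \<sigma> = \<sigma>"
  by (simp add: shift_def)

lemma shift_shift [simp]: "shift a d (shift a d' \<sigma>) = shift a (d + d') \<sigma>"
  by (simp add: shift_def algebra_simps)

lemma shift_other [simp]: "b \<noteq> a \<Longrightarrow> shift a d \<sigma> b = \<sigma> b"
  by (simp add: shift_def)

lemma shift_same [simp]: "shift a d \<sigma> a = (fst (\<sigma> a), snd (\<sigma> a) + int d)"
  by (simp add: shift_def)

lemma shift_upd: "b \<noteq> a \<Longrightarrow> shift a d (\<sigma>(b := t)) = (shift a d \<sigma>)(b := t)"
  by (auto simp: shift_def fun_eq_iff)

lemma runs_Mv_shift: "runs (Mv a MoveRight) \<sigma> 1 (shift a 1 \<sigma>)"
  using runs_Mv[of \<sigma> a "fst (\<sigma> a)" "snd (\<sigma> a)" MoveRight] by (simp add: shift_def)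

text \<open>While the loop runs, tape \<open>r\<close> carries the mark and a displaced head. The
  hypothesis on \<open>p\<close> therefore speaks of arbitrary tapes and asks only for the counter
  to be in place, which is all that skipping a row relies on.\<close>

lemma runs_iterate:
  assumes p: "\<And>\<sigma>. \<sigma> counter = (index_tape n, 0) \<Longrightarrow> runs p \<sigma> T (shift a d \<sigma>)"
    and ne: "a \<noteq> r" "r \<noteq> counter" "a \<noteq> counter"
    and \<sigma>: "\<sigma> counter = (index_tape n, 0)" "\<sigma> r = (index_tape n, int v)" "v < n"
  shows "runs (iterate r p) \<sigma> (n * (T + 4) + 7) (shift a (v * d) \<sigma>)"
proof -
  let ?f = "(index_tape n)(int v := 2)"
  let ?S = "\<lambda>i. (shift a (i * d) \<sigma>)(r := (?f, int i))"
  have 1: "runs (Put r 2) \<sigma> 1 (\<sigma>(r := (?f, int v)))"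
    using runs_Put[of \<sigma> r] \<sigma>(2) by blast
  have 2: "runs (rewind r) (\<sigma>(r := (?f, int v))) (2 * n + 4) (?S 0)"
    using runs_rewind[of "\<sigma>(r := (?f, int v))" r ?f v n] \<sigma>(3)
    by (simp add: index_tape_def)
  have 3: "runs (Loop r (\<lambda>x. x \<noteq> 2) (p ;; Mv r MoveRight)) (?S 0) (v * Suc (T + 1) + 1) (?S v)"
  proof (rule runs_Loop)
    fix i assume i: "i < v"
    have a: "runs p (?S i) T ((shift a (Suc i * d) \<sigma>)(r := (?f, int i)))"
      using p[of "?S i"] ne \<sigma>(1) by (simp add: shift_upd)
    have b: "runs (Mv r MoveRight) ((shift a (Suc i * d) \<sigma>)(r := (?f, int i))) 1 (?S (Suc i))"
      using runs_Mv[of "(shift a (Suc i * d) \<sigma>)(r := (?f, int i))" r ?f "int i" MoveRight]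
      by (simp add: add.commute)
    show "tape_read (?S i r) \<noteq> 2 \<and> runs (p ;; Mv r MoveRight) (?S i) (T + 1) (?S (Suc i))"
      using i runs_Seq[OF a b] by (simp add: index_tape_def)
  qed simp
  have "?f(int v := 1) = index_tape n"
    using \<sigma>(3) by (auto simp: index_tape_def)
  then have 4: "runs (Put r 1) (?S v) 1 (shift a (v * d) \<sigma>)"
    using runs_Put[of "?S v" r ?f "int v" 1] \<sigma>(2) ne(1)
    by (metis fun_upd_same fun_upd_upd fun_upd_triv shift_other)
  have "runs (iterate r p) \<sigma> (1 + (2 * n + 4 + (v * Suc (T + 1) + 1 + 1))) (shift a (v * d) \<sigma>)"
    unfolding iterate_def by (intro runs_Seq[OF 1] runs_Seq[OF 2] runs_Seq[OF 3] 4)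
  moreover have "v * Suc (T + 1) \<le> n * Suc (T + 1)"
    using \<sigma>(3) by (intro mult_le_mono1) simp
  ultimately show ?thesis
    by (elim runs_mono) (simp add: algebra_simps)
qed

lemma runs_skip_row:
  assumes "\<sigma> counter = (index_tape n, 0)" "a \<noteq> counter"
  shows "runs (skip_row a) \<sigma> (5 * n + 5) (shift a n \<sigma>)"
proof -
  let ?S = "\<lambda>i. (shift a i \<sigma>)(counter := (index_tape n, int i))"
  have "runs (Loop counter (\<lambda>x. x = 1) (Mv a MoveRight ;; Mv counter MoveRight)) (?S 0)
      (n * Suc (1 + 1) + 1) (?S n)"
  proof (rule runs_Loop)
    fix i assume i: "i < n"
    have a: "runs (Mv a MoveRight) (?S i) 1 ((shift a (Suc i) \<sigma>)(counter := (index_tape n, int i)))"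
      using runs_Mv_shift[of a "?S i"] assms(2) by (simp add: shift_upd)
    have b: "runs (Mv counter MoveRight) ((shift a (Suc i) \<sigma>)(counter := (index_tape n, int i))) 1
        (?S (Suc i))"
      using runs_Mv[of "(shift a (Suc i) \<sigma>)(counter := (index_tape n, int i))" counter
          "index_tape n" "int i" MoveRight] by (simp add: add.commute)
    show "tape_read (?S i counter) = 1 \<and>
        runs (Mv a MoveRight ;; Mv counter MoveRight) (?S i) (1 + 1) (?S (Suc i))"
      using i runs_Seq[OF a b] by (simp add: index_tape_def)
  qed (simp add: index_tape_def)
  moreover have "?S 0 = \<sigma>" using assms(1) by (auto simp: fun_eq_iff)
  moreover have "runs (rewind counter) (?S n) (2 * n + 4) (shift a n \<sigma>)"
    using runs_rewind_index[of "?S n" counter n n] assms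
    by (metis fun_upd_same fun_upd_triv fun_upd_upd le_refl shift_other)
  ultimately have "runs (skip_row a) \<sigma> (n * Suc (1 + 1) + 1 + (2 * n + 4)) (shift a n \<sigma>)"
    unfolding skip_row_def by (metis runs_Seq)
  then show ?thesis by (rule runs_mono) simp
qed

lemma runs_seek:
  assumes "a \<in> arrays" "u \<in> indices" "v \<in> indices"
    and \<sigma>: "\<sigma> counter = (index_tape n, 0)" "\<sigma> u = (index_tape n, int i)" "\<sigma> v = (index_tape n, int j)"
    and "i < n" "j < n"
  shows "runs (seek a u v) \<sigma> (5 * n\<^sup>2 + 14 * n + 15) (shift a (1 + (i * n + j)) \<sigma>)"
proof -
  have ne: "a \<noteq> u" "a \<noteq> v" "a \<noteq> counter" "u \<noteq> counter" "v \<noteq> counter"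
    using assms(1-3) by (auto simp: arrays_def indices_def)
  let ?\<sigma>1 = "shift a 1 \<sigma>" and ?\<sigma>2 = "shift a (1 + i * n) \<sigma>"
  have 2: "runs (iterate u (skip_row a)) ?\<sigma>1 (n * ((5 * n + 5) + 4) + 7) ?\<sigma>2"
    using runs_iterate[of n "skip_row a" "5 * n + 5" a n u ?\<sigma>1 i] runs_skip_row[of _ n a] ne \<sigma> assms(7)
    by (simp add: add.commute)
  have 3: "runs (iterate v (Mv a MoveRight)) ?\<sigma>2 (n * (1 + 4) + 7) (shift a (1 + (i * n + j)) \<sigma>)"
    using runs_iterate[of n "Mv a MoveRight" 1 a 1 v ?\<sigma>2 j] runs_Mv_shift[of a] ne \<sigma> assms(8)
    by (simp add: ac_simps)
  show ?thesis
    unfolding seek_def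
    by (rule runs_mono[OF runs_Seq[OF runs_Mv_shift runs_Seq[OF 2 3]]])
      (simp add: algebra_simps power2_eq_square)
qed

lemma index_less_square:
  fixes i j n :: nat
  assumes "i < n" "j < n"
  shows "i * n + j < n\<^sup>2"
proof -
  have "i * n + j < Suc i * n" using assms(2) by simp
  also have "\<dots> \<le> n * n" using assms(1) by (intro mult_le_mono1) simp
  finally show ?thesis by (simp add: power2_eq_square)
qed

lemma index_inj:
  fixes i j i' j' n :: nat
  assumes "j < n" "j' < n"
  shows "i * n + j = i' * n + j' \<longleftrightarrow> i = i' \<and> j = j'"
proof
  assume eq: "i * n + j = i' * n + j'"
  have "(i * n + j) div n = i" "(i' * n + j') div n = i'"
    using assms by simp_all
  then show "i = i' \<and> j = j'" using eq by simp
qed simp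

lemma runs_go_home:
  assumes "\<sigma> a = (f, h + 1 + int x)" "f h = 3" "\<forall>i > h. f i < 3" "x < n\<^sup>2"
  shows "runs (go_home a) \<sigma> (2 * n\<^sup>2 + 3) (\<sigma>(a := (f, h)))"
proof -
  let ?S = "\<lambda>i. \<sigma>(a := (f, h + 1 + int x - int i))"
  have "runs (go_home a) (?S 0) (Suc x * Suc 1 + 1) (?S (Suc x))"
    unfolding go_home_def
  proof (rule runs_Loop)
    fix i assume "i < Suc x"
    then have "f (h + 1 + int x - int i) < 3" using assms(3) by simp
    then show "tape_read (?S i a) \<noteq> 3 \<and> runs (Mv a MoveLeft) (?S i) 1 (?S (Suc i))"
      using runs_Mv[of "?S i" a f "h + 1 + int x - int i" MoveLeft] by (simp add: algebra_simps)
  qed (use assms in simp)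
  moreover have "?S 0 = \<sigma>" using assms(1) by (auto simp: fun_eq_iff)
  moreover have "?S (Suc x) = \<sigma>(a := (f, h))" by simp
  ultimately have "runs (go_home a) \<sigma> (Suc x * Suc 1 + 1) (\<sigma>(a := (f, h)))"
    by metis
  then show ?thesis by (rule runs_mono) (use assms(4) in simp)
qed

text \<open>Different entries have different addresses by \<open>index_inj\<close>, so writing one
  cell changes one entry.\<close>

lemma array_tape_update:
  assumes "array_tape n g (f, h)" "i < n" "j < n" "x < 3"
  shows "array_tape n (g((i, j) := x)) (f(h + 1 + int (i * n + j) := x), h)"
  using assms index_inj[of _ n j _ i] unfolding array_tape_def
  by (auto simp flip: of_nat_mult of_nat_add)

lemma represents_index: "represents n \<rho> s \<sigma> \<Longrightarrow> u \<in> indices \<Longrightarrow> \<rho> u < n \<and> \<sigma> u = (index_tape n, int (\<rho> u))"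
  by (simp add: represents_def)

lemma represents_seek:
  assumes "represents n \<rho> s \<sigma>" "a \<in> arrays" "u \<in> indices" "v \<in> indices"
  obtains f h where "\<sigma> a = (f, h)" "array_tape n (\<lambda>uv. fst s (a, uv)) (f, h)"
    "runs (seek a u v) \<sigma> (5 * n\<^sup>2 + 14 * n + 15) (\<sigma>(a := (f, h + 1 + int (\<rho> u * n + \<rho> v))))"
proof -
  obtain f h where fh: "\<sigma> a = (f, h)" by fastforce
  have "runs (seek a u v) \<sigma> (5 * n\<^sup>2 + 14 * n + 15) (shift a (1 + (\<rho> u * n + \<rho> v)) \<sigma>)"
    using assms by (intro runs_seek) (auto simp: represents_def)
  moreover have "shift a (1 + (\<rho> u * n + \<rho> v)) \<sigma> = \<sigma>(a := (f, h + 1 + int (\<rho> u * n + \<rho> v)))"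
    using fh by (simp add: shift_def add.assoc)
  ultimately show thesis
    using assms(1,2) fh by (intro that[of f h]) (auto simp: represents_def)
qed

lemma represents_update:
  assumes "represents n \<rho> s \<sigma>" "a \<in> arrays" "array_tape n (\<lambda>uv. st (a, uv)) t"
    "\<And>b uv. b \<noteq> a \<Longrightarrow> st (b, uv) = fst s (b, uv)"
  shows "represents n \<rho> (st, snd s) (\<sigma>(a := t))"
  using assms by (auto simp: represents_def arrays_def indices_def)

lemma tape_word_snoc: "(tape_word xs)(int (length xs) := bit_symbol b) = tape_word (xs @ [b])"
  by (auto simp: tape_word_def fun_eq_iff nth_append)

text \<open>A loop counts from wherever the head of its index stands. Hence all loop indices of
  \<open>c\<close> are required to be at 0, and each loop rewinds its own so that the requirement
  holds again afterwards.\<close>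

lemma compile_correct:
  assumes "represents n \<rho> s \<sigma>" "wf_cmd c" "\<forall>u \<in> loop_vars c. \<rho> u = 0"
  shows "\<exists>\<sigma>'. runs (compile c) \<sigma> (poly (time c) n) \<sigma>' \<and> represents n \<rho> (run n c \<rho> s) \<sigma>'"
  using assms
proof (induction c arbitrary: \<rho> s \<sigma>)
  case Nop
  have "runs (Mv 1 MoveStay) \<sigma> 1 \<sigma>"
    using runs_Mv[of \<sigma> 1 "fst (\<sigma> 1)" "snd (\<sigma> 1)" MoveStay] by simp
  then show ?case using Nop by auto
next
  case (Then c c')
  obtain \<sigma>1 where 1: "runs (compile c) \<sigma> (poly (time c) n) \<sigma>1" "represents n \<rho> (run n c \<rho> s) \<sigma>1"
    using Then.IH(1)[of \<rho> s \<sigma>] Then.prems by auto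
  obtain \<sigma>2 where 2: "runs (compile c') \<sigma>1 (poly (time c') n) \<sigma>2"
    "represents n \<rho> (run n c' \<rho> (run n c \<rho> s)) \<sigma>2"
    using Then.IH(2)[OF 1(2)] Then.prems by auto
  show ?case using runs_Seq[OF 1(1) 2(1)] 2(2) by auto
next
  case (Write a u v x)
  then have a: "a \<in> arrays" "u \<in> indices" "v \<in> indices" "x < 3" by auto
  let ?i = "\<rho> u * n + \<rho> v"
  obtain f h where fh: "\<sigma> a = (f, h)" "array_tape n (\<lambda>uv. fst s (a, uv)) (f, h)"
    and 1: "runs (seek a u v) \<sigma> (5 * n\<^sup>2 + 14 * n + 15) (\<sigma>(a := (f, h + 1 + int ?i)))"
    by (rule represents_seek[OF Write.prems(1) a(1-3)])
  let ?f = "f(h + 1 + int ?i := x)"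
  have less: "\<rho> u < n" "\<rho> v < n" using Write.prems(1) a represents_index by auto
  have 2: "runs (Put a x) (\<sigma>(a := (f, h + 1 + int ?i))) 1 (\<sigma>(a := (?f, h + 1 + int ?i)))"
    using runs_Put[of "\<sigma>(a := (f, h + 1 + int ?i))" a f "h + 1 + int ?i" x] by simp
  have arr: "array_tape n ((\<lambda>uv. fst s (a, uv))((\<rho> u, \<rho> v) := x)) (?f, h)"
    using array_tape_update[OF fh(2) less a(4)] .
  have 3: "runs (go_home a) (\<sigma>(a := (?f, h + 1 + int ?i))) (2 * n\<^sup>2 + 3) (\<sigma>(a := (?f, h)))"
    using runs_go_home[of "\<sigma>(a := (?f, h + 1 + int ?i))" a ?f h ?i n] index_less_square[OF less] arr
    by (simp add: array_tape_def)
  have "runs (compile (Write a u v x)) \<sigma> (poly (time (Write a u v x)) n) (\<sigma>(a := (?f, h)))"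
    using runs_mono[OF runs_Seq[OF 1 runs_Seq[OF 2 3]]]
    by (simp add: algebra_simps power2_eq_square)
  moreover have "represents n \<rho> (run n (Write a u v x) \<rho> s) (\<sigma>(a := (?f, h)))"
    using represents_update[OF Write.prems(1) a(1), of "(fst s)((a, \<rho> u, \<rho> v) := x)"] arr
    by (simp add: fun_upd_def)
  ultimately show ?case by blast
next
  case (If a u v x c c')
  then have a: "a \<in> arrays" "u \<in> indices" "v \<in> indices" by auto
  let ?i = "\<rho> u * n + \<rho> v"
  obtain f h where fh: "\<sigma> a = (f, h)" "array_tape n (\<lambda>uv. fst s (a, uv)) (f, h)"
    and 1: "runs (seek a u v) \<sigma> (5 * n\<^sup>2 + 14 * n + 15) (\<sigma>(a := (f, h + 1 + int ?i)))"
    by (rule represents_seek[OF If.prems(1) a(1-3)])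
  have less: "\<rho> u < n" "\<rho> v < n" using If.prems(1) a represents_index by auto
  have "runs (go_home a) (\<sigma>(a := (f, h + 1 + int ?i))) (2 * n\<^sup>2 + 3) (\<sigma>(a := (f, h)))"
    using runs_go_home[of "\<sigma>(a := (f, h + 1 + int ?i))" a f h ?i n] index_less_square[OF less] fh(2)
    by (simp add: array_tape_def)
  then have 2: "runs (go_home a) (\<sigma>(a := (f, h + 1 + int ?i))) (2 * n\<^sup>2 + 3) \<sigma>"
    using fh(1) by (metis fun_upd_triv)
  have read: "tape_read ((\<sigma>(a := (f, h + 1 + int ?i))) a) = fst s (a, \<rho> u, \<rho> v)"
    using fh(2) less by (simp add: array_tape_def)
  show ?case
  proof (cases "fst s (a, \<rho> u, \<rho> v) = x")
    case True
    then obtain \<sigma>' where 3: "runs (compile c) \<sigma> (poly (time c) n) \<sigma>'"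
      "represents n \<rho> (run n c \<rho> s) \<sigma>'"
      using If.IH(1)[of \<rho> s \<sigma>] If.prems by auto
    have "runs (compile (If a u v x c c')) \<sigma> (poly (time (If a u v x c c')) n) \<sigma>'"
      using runs_mono[OF runs_Seq[OF 1 runs_Cond_True[OF _ runs_Seq[OF 2 3(1)], of "\<lambda>y. y = x"]]]
        read True by (simp add: algebra_simps power2_eq_square)
    then show ?thesis using 3(2) True by auto
  next
    case False
    then obtain \<sigma>' where 3: "runs (compile c') \<sigma> (poly (time c') n) \<sigma>'"
      "represents n \<rho> (run n c' \<rho> s) \<sigma>'"
      using If.IH(2)[of \<rho> s \<sigma>] If.prems by auto
    have "runs (compile (If a u v x c c')) \<sigma> (poly (time (If a u v x c c')) n) \<sigma>'"
      using runs_mono[OF runs_Seq[OF 1 runs_Cond_False[OF _ runs_Seq[OF 2 3(1)], of "\<lambda>y. y = x"]]]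
        read False by (simp add: algebra_simps power2_eq_square)
    then show ?thesis using 3(2) False by auto
  qed
next
  case (For u c)
  then have u: "u \<in> indices" "u \<notin> loop_vars c" "wf_cmd c" "\<rho> u = 0" by auto
  have n: "0 < n" using For.prems(1) u(1) represents_index by fastforce
  define S where "S i = fold (\<lambda>i. run n c (\<rho>(u := i))) [0..<i] s" for i
  \<comment> \<open>After the last round the head of \<open>u\<close> stands at \<open>n\<close>,
    which is not the value of any admissible index. The invariant therefore describes the tapes with
    this head put back to 0.\<close>
  define I where "I i \<sigma> \<longleftrightarrow> \<sigma> u = (index_tape n, int i) \<and>
    represents n \<rho> (S i) (\<sigma>(u := (index_tape n, 0)))" for i \<sigma>
  have "\<exists>\<sigma>'. runs (Loop u (\<lambda>x. x = 1) (compile c ;; Mv u MoveRight)) \<sigma>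
      (n * Suc (poly (time c) n + 1) + 1) \<sigma>' \<and> I n \<sigma>'"
  proof (rule runs_Loop_inv)
    fix i \<sigma> assume i: "i < n" and I: "I i \<sigma>"
    have "represents n (\<rho>(u := i)) (S i) \<sigma>"
      using I i u(1) by (auto simp: I_def represents_def arrays_def indices_def split: if_splits)
    moreover have "\<forall>w \<in> loop_vars c. (\<rho>(u := i)) w = 0" using For.prems(3) u(2) by auto
    moreover have "S (Suc i) = run n c (\<rho>(u := i)) (S i)" by (simp add: S_def)
    ultimately obtain \<sigma>1 where 1: "runs (compile c) \<sigma> (poly (time c) n) \<sigma>1"
      "represents n (\<rho>(u := i)) (S (Suc i)) \<sigma>1"
      using For.IH[of "\<rho>(u := i)" "S i" \<sigma>] u(3) by (auto simp del: fun_upd_apply)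
    have \<sigma>1: "\<sigma>1 u = (index_tape n, int i)" using represents_index[OF 1(2) u(1)] by simp
    have 2: "runs (Mv u MoveRight) \<sigma>1 1 (\<sigma>1(u := (index_tape n, int (Suc i))))"
      using runs_Mv[of \<sigma>1 u "index_tape n" "int i" MoveRight] \<sigma>1 by (simp add: add.commute)
    have "I (Suc i) (\<sigma>1(u := (index_tape n, int (Suc i))))"
      using 1(2) u(1,4) n by (auto simp: I_def represents_def arrays_def indices_def split: if_splits)
    moreover have "tape_read (\<sigma> u) = 1" using I i by (simp add: I_def index_tape_def)
    ultimately show "tape_read (\<sigma> u) = 1 \<and>
        (\<exists>\<sigma>'. runs (compile c ;; Mv u MoveRight) \<sigma> (poly (time c) n + 1) \<sigma>' \<and> I (Suc i) \<sigma>')"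
      using runs_Seq[OF 1(1) 2] by blast
  next
    have "\<sigma> u = (index_tape n, 0)" using represents_index[OF For.prems(1) u(1)] u(4) by simp
    then have "\<sigma>(u := (index_tape n, 0)) = \<sigma>" by (metis fun_upd_triv)
    then show "I 0 \<sigma>" using For.prems(1) \<open>\<sigma> u = _\<close> by (simp add: I_def S_def)
  qed (simp add: I_def index_tape_def)
  then obtain \<sigma>1 where 1: "runs (Loop u (\<lambda>x. x = 1) (compile c ;; Mv u MoveRight)) \<sigma>
      (n * Suc (poly (time c) n + 1) + 1) \<sigma>1" and I: "I n \<sigma>1" by blast
  have 2: "runs (rewind u) \<sigma>1 (2 * n + 4) (\<sigma>1(u := (index_tape n, 0)))"
    using I by (intro runs_rewind_index[of _ _ _ n]) (auto simp: I_def)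
  have "runs (compile (For u c)) \<sigma> (poly (time (For u c)) n) (\<sigma>1(u := (index_tape n, 0)))"
    using runs_mono[OF runs_Seq[OF 1 2]] by (simp add: algebra_simps)
  then show ?case using I by (auto simp: I_def S_def)
next
  case (Out b)
  let ?out = "snd s" and ?k = "int (length (snd s))"
  have \<sigma>1: "\<sigma> 1 = (tape_word ?out, ?k)" using Out.prems(1) by (simp add: represents_def)
  have 1: "runs (Put 1 (bit_symbol b)) \<sigma> 1 (\<sigma>(1 := (tape_word (?out @ [b]), ?k)))"
    using runs_Put[of \<sigma> 1 _ _ "bit_symbol b"] \<sigma>1 tape_word_snoc by metis
  have 2: "runs (Mv 1 MoveRight) (\<sigma>(1 := (tape_word (?out @ [b]), ?k))) 1
      (\<sigma>(1 := (tape_word (?out @ [b]), ?k + 1)))"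
    using runs_Mv[of "\<sigma>(1 := (tape_word (?out @ [b]), ?k))" 1 _ ?k MoveRight] by simp
  have "represents n \<rho> (run n (Out b) \<rho> s) (\<sigma>(1 := (tape_word (?out @ [b]), ?k + 1)))"
    using Out.prems(1) by (auto simp: represents_def arrays_def indices_def)
  then show ?case using runs_Seq[OF 1 2] by (auto simp: numeral_2_eq_2)
qed

section \<open>Reading the input\<close>

definition index_tapes :: "nat list" where
  "index_tapes = [counter..<ntapes]"

definition sequence :: "(nat \<Rightarrow> prog) \<Rightarrow> nat list \<Rightarrow> prog" where
  "sequence p ks = foldr (\<lambda>k q. p k ;; q) ks (Mv 1 MoveStay)"

text \<open>Each \<open>True\<close> of the unary number is copied to the counter and all index
  tapes in the same round, so that they get \<open>n\<close> ones at once. The \<open>False\<close>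
  behind them is overwritten by the marker of array 0.\<close>

definition prepare :: prog where
  "prepare =
     Loop 0 (\<lambda>x. x = 2) (Mv 0 MoveRight ;; sequence (\<lambda>r. Put r 1 ;; Mv r MoveRight) index_tapes) ;;
     Put 0 3 ;;
     sequence (\<lambda>r. Mv r MoveLeft ;; Loop r (\<lambda>x. x = 1) (Mv r MoveLeft) ;; Put r 3 ;; Mv r MoveRight)
       index_tapes ;;
     sequence (\<lambda>a. Put a 3) [2..<11]"

text \<open>Each \<open>p k\<close> reads and changes only tape \<open>k\<close>, so the effects on
  distinct tapes do not interfere and can be stated all at once.\<close>

lemma runs_sequence:
  assumes "\<And>k \<sigma>'. k \<in> set ks \<Longrightarrow> \<sigma>' k = \<sigma> k \<Longrightarrow> runs (p k) \<sigma>' T (\<sigma>'(k := g k))" "distinct ks"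
  shows "runs (sequence p ks) \<sigma> (length ks * T + 1) (\<lambda>k. if k \<in> set ks then g k else \<sigma> k)"
  using assms
proof (induction ks arbitrary: \<sigma>)
  case Nil
  then show ?case using runs_Mv[of \<sigma> 1 "fst (\<sigma> 1)" "snd (\<sigma> 1)" MoveStay] by (simp add: sequence_def)
next
  case (Cons k ks)
  have 1: "runs (p k) \<sigma> T (\<sigma>(k := g k))" using Cons.prems(1)[of k \<sigma>] by (simp del: fun_upd_apply)
  have "runs (sequence p ks) (\<sigma>(k := g k)) (length ks * T + 1)
      (\<lambda>l. if l \<in> set ks then g l else (\<sigma>(k := g k)) l)"
  proof (rule Cons.IH)
    fix l \<sigma>' assume "l \<in> set ks" "\<sigma>' l = (\<sigma>(k := g k)) l"
    moreover from this have "l \<noteq> k" using Cons.prems(2) by auto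
    ultimately show "runs (p l) \<sigma>' T (\<sigma>'(l := g l))" by (intro Cons.prems(1)) auto
  qed (use Cons.prems(2) in simp)
  moreover have "(\<lambda>l. if l \<in> set ks then g l else (\<sigma>(k := g k)) l) = (\<lambda>l. if l \<in> set (k # ks) then g l else \<sigma> l)"
    using Cons.prems(2) by (auto simp: fun_eq_iff)
  ultimately have "runs (sequence p ks) (\<sigma>(k := g k)) (length ks * T + 1)
      (\<lambda>l. if l \<in> set (k # ks) then g l else \<sigma> l)" by simp
  from runs_Seq[OF 1 this] show ?case by (simp add: sequence_def add.assoc)
qed

lemma length_index_tapes: "length index_tapes = 9"
  by (simp add: index_tapes_def)

definition array_blank :: "int \<Rightarrow> nat" where
  "array_blank = (tape_word [])(0 := 3)"

text \<open>Array 0 holds input symbols: 2 for an edge and 1 for a non-edge, while the other arrays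
  start with blanks. Tests for an edge therefore compare with 2.\<close>

definition initial_store :: "nat \<Rightarrow> (nat \<Rightarrow> nat \<Rightarrow> bool) \<Rightarrow> store" where
  "initial_store n E = (\<lambda>(a, u, v). if a = 0 \<and> u < n \<and> v < n then bit_symbol (E u v) else 0)"

definition enc_matrix :: "nat \<Rightarrow> (nat \<Rightarrow> nat \<Rightarrow> bool) \<Rightarrow> bool list" where
  "enc_matrix n E = concat (map (\<lambda>i. map (E i) [0..<n]) [0..<n])"

lemma enc_matrix_nth:
  assumes "u < n" "v < n"
  shows "u * n + v < length (enc_matrix n E)" "enc_matrix n E ! (u * n + v) = E u v"
proof -
  have len: "length (concat (map (\<lambda>i. map (E i) [0..<n]) [0..<m])) = m * n" for m
    by (induction m) auto
  show "u * n + v < length (enc_matrix n E)"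
    using len[of n] index_less_square[OF assms] by (simp add: enc_matrix_def power2_eq_square)
  have "[0..<n] = [0..<u] @ u # [Suc u..<n]"
    using assms(1) upt_add_eq_append[of 0 u "n - u"] upt_conv_Cons[of u n] by simp
  then have "enc_matrix n E = concat (map (\<lambda>i. map (E i) [0..<n]) [0..<u]) @ map (E u) [0..<n] @
      concat (map (\<lambda>i. map (E i) [0..<n]) [Suc u..<n])"
    unfolding enc_matrix_def by (metis concat.simps(2) concat_append list.map(2) map_append)
  then show "enc_matrix n E ! (u * n + v) = E u v"
    using len[of u] assms(2) by (simp add: nth_append)
qed

lemma prepare_correct:
  assumes n: "0 < n"
  shows "\<exists>\<sigma>. runs prepare (init_tapes (enc_unary n @ enc_matrix n E)) (100 * n + 200) \<sigma> \<and>
    represents n (\<lambda>_. 0) (initial_store n E, []) \<sigma>"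
proof -
  let ?w = "enc_unary n @ enc_matrix n E"
  let ?idx = "set index_tapes"
  have idx: "k \<in> ?idx \<longleftrightarrow> 11 \<le> k \<and> k < ntapes" for k by (auto simp: index_tapes_def)
  have dist: "distinct index_tapes" by (simp add: index_tapes_def)
  let ?ones = "\<lambda>i::nat. \<lambda>j::int. if 0 \<le> j \<and> j < int i then 1::nat else 0"
  \<comment> \<open>After \<open>i\<close> rounds each index tape has \<open>i\<close> ones, and all
    of these heads stand at \<open>i\<close> together with the input head.\<close>
  define S where "S i = (\<lambda>k. if k = 0 then (tape_word ?w, int i) else if k \<in> ?idx then (?ones i, int i)
     else (tape_word [], 0))" for i
  have w2: "tape_word ?w (int i) = 2" if "i < n" for i
    using that by (auto simp: tape_word_def enc_unary_def nth_append bit_symbol_def)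
  have wn: "tape_word ?w (int n) = 1"
    by (auto simp: tape_word_def enc_unary_def nth_append bit_symbol_def)
  have S0: "S 0 = init_tapes ?w"
    by (auto simp: S_def init_tapes_def tape_word_def fun_eq_iff)
  have 1: "runs (Loop 0 (\<lambda>x. x = 2) (Mv 0 MoveRight ;; sequence (\<lambda>r. Put r 1 ;; Mv r MoveRight) index_tapes))
      (S 0) (n * Suc (1 + (9 * (1 + 1) + 1)) + 1) (S n)"
  proof (rule runs_Loop)
    fix i assume i: "i < n"
    have a: "runs (Mv 0 MoveRight) (S i) 1 ((S i)(0 := (tape_word ?w, int (Suc i))))"
      using runs_Mv[of "S i" 0 "tape_word ?w" "int i" MoveRight] by (simp add: S_def add.commute)
    have "runs (sequence (\<lambda>r. Put r 1 ;; Mv r MoveRight) index_tapes) ((S i)(0 := (tape_word ?w, int (Suc i))))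
       (length index_tapes * (1 + 1) + 1)
       (\<lambda>k. if k \<in> ?idx then (?ones (Suc i), int (Suc i)) else ((S i)(0 := (tape_word ?w, int (Suc i)))) k)"
    proof (rule runs_sequence[OF _ dist])
      fix r \<sigma>' assume r: "r \<in> ?idx" and eq: "\<sigma>' r = ((S i)(0 := (tape_word ?w, int (Suc i)))) r"
      have "\<sigma>' r = (?ones i, int i)" using r eq by (auto simp: S_def idx)
      then have c: "runs (Put r 1) \<sigma>' 1 (\<sigma>'(r := ((?ones i)(int i := 1), int i)))"
        by (rule runs_Put)
      have ones: "(?ones i)(int i := 1) = ?ones (Suc i)" by (auto simp: fun_eq_iff)
      have "runs (Mv r MoveRight) (\<sigma>'(r := (?ones (Suc i), int i))) 1 (\<sigma>'(r := (?ones (Suc i), int (Suc i))))"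
        using runs_Mv[of "\<sigma>'(r := (?ones (Suc i), int i))" r "?ones (Suc i)" "int i" MoveRight]
        by (simp add: add.commute)
      then show "runs (Put r 1 ;; Mv r MoveRight) \<sigma>' (1 + 1) (\<sigma>'(r := (?ones (Suc i), int (Suc i))))"
        using runs_Seq[OF c] unfolding ones by blast
    qed
    moreover have "(\<lambda>k. if k \<in> ?idx then (?ones (Suc i), int (Suc i))
        else ((S i)(0 := (tape_word ?w, int (Suc i)))) k) = S (Suc i)"
      by (auto simp: S_def fun_eq_iff idx)
    ultimately have b: "runs (sequence (\<lambda>r. Put r 1 ;; Mv r MoveRight) index_tapes)
        ((S i)(0 := (tape_word ?w, int (Suc i)))) (9 * (1 + 1) + 1) (S (Suc i))"
      by (simp only: length_index_tapes)
    show "tape_read (S i 0) = 2 \<and> runs (Mv 0 MoveRight ;; sequence (\<lambda>r. Put r 1 ;; Mv r MoveRight) index_tapes)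
        (S i) (1 + (9 * (1 + 1) + 1)) (S (Suc i))"
      using runs_Seq[OF a b] w2[OF i] by (simp add: S_def)
  qed (use wn in \<open>simp add: S_def\<close>)
  let ?f = "(tape_word ?w)(int n := 3)"
  let ?\<sigma>2 = "(S n)(0 := (?f, int n))"
  have 2: "runs (Put 0 3) (S n) 1 ?\<sigma>2"
    by (rule runs_Put) (simp add: S_def)
  define \<sigma>3 where "\<sigma>3 = (\<lambda>k. if k \<in> ?idx then (index_tape n, 0) else ?\<sigma>2 k)"
  have "runs (sequence (\<lambda>r. Mv r MoveLeft ;; Loop r (\<lambda>x. x = 1) (Mv r MoveLeft) ;; Put r 3 ;; Mv r MoveRight)
       index_tapes) ?\<sigma>2 (length index_tapes * (1 + ((n * Suc 1 + 1) + (1 + 1))) + 1) \<sigma>3"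
    unfolding \<sigma>3_def
  proof (rule runs_sequence[OF _ dist])
    fix r \<sigma>' assume r: "r \<in> ?idx" and eq: "\<sigma>' r = ?\<sigma>2 r"
    let ?S = "\<lambda>i. \<sigma>'(r := (?ones n, int n - 1 - int i))"
    have "\<sigma>' r = (?ones n, int n)" using r eq by (auto simp: S_def idx)
    then have a: "runs (Mv r MoveLeft) \<sigma>' 1 (?S 0)"
      using runs_Mv[of \<sigma>' r "?ones n" "int n" MoveLeft] by simp
    have b: "runs (Loop r (\<lambda>x. x = 1) (Mv r MoveLeft)) (?S 0) (n * Suc 1 + 1) (?S n)"
    proof (rule runs_Loop)
      fix i assume "i < n"
      then show "tape_read (?S i r) = 1 \<and> runs (Mv r MoveLeft) (?S i) 1 (?S (Suc i))"
        using runs_Mv[of "?S i" r "?ones n" "int n - 1 - int i" MoveLeft] by (simp add: algebra_simps)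
    qed simp
    have ones: "(?ones n)(-1 := 3) = index_tape n" by (auto simp: index_tape_def fun_eq_iff)
    have c: "runs (Put r 3) (?S n) 1 (\<sigma>'(r := (index_tape n, -1)))"
      using runs_Put[of "?S n" r "?ones n" "-1" 3] ones by simp
    have d: "runs (Mv r MoveRight) (\<sigma>'(r := (index_tape n, -1))) 1 (\<sigma>'(r := (index_tape n, 0)))"
      using runs_Mv[of "\<sigma>'(r := (index_tape n, -1))" r "index_tape n" "-1" MoveRight] by simp
    show "runs (Mv r MoveLeft ;; Loop r (\<lambda>x. x = 1) (Mv r MoveLeft) ;; Put r 3 ;; Mv r MoveRight) \<sigma>'
       (1 + ((n * Suc 1 + 1) + (1 + 1))) (\<sigma>'(r := (index_tape n, 0)))"
      by (intro runs_Seq[OF a] runs_Seq[OF b] runs_Seq[OF c] d)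
  qed
  then have 3: "runs (sequence (\<lambda>r. Mv r MoveLeft ;; Loop r (\<lambda>x. x = 1) (Mv r MoveLeft) ;; Put r 3 ;; Mv r MoveRight)
       index_tapes) ?\<sigma>2 (9 * (1 + ((n * Suc 1 + 1) + (1 + 1))) + 1) \<sigma>3"
    by (simp only: length_index_tapes)
  define \<sigma>4 where "\<sigma>4 = (\<lambda>k. if k \<in> set [2..<11] then (array_blank, 0) else \<sigma>3 k)"
  have 4: "runs (sequence (\<lambda>a. Put a 3) [2..<11]) \<sigma>3 (length [2..<11] * 1 + 1) \<sigma>4"
    unfolding \<sigma>4_def
  proof (rule runs_sequence)
    fix a \<sigma>' assume "a \<in> set [2..<11]" "\<sigma>' a = \<sigma>3 a"
    then have "\<sigma>' a = (tape_word [], 0)" by (auto simp: \<sigma>3_def S_def idx)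
    then show "runs (Put a 3) \<sigma>' 1 (\<sigma>'(a := (array_blank, 0)))"
      unfolding array_blank_def by (rule runs_Put)
  qed simp
  have "runs prepare (S 0) (n * Suc (1 + (9 * (1 + 1) + 1)) + 1 + (1 +
      ((9 * (1 + ((n * Suc 1 + 1) + (1 + 1))) + 1) + (length [2..<11] * 1 + 1)))) \<sigma>4"
    unfolding prepare_def by (intro runs_Seq[OF 1] runs_Seq[OF 2] runs_Seq[OF 3] 4)
  then have "runs prepare (init_tapes ?w) (100 * n + 200) \<sigma>4"
    unfolding S0 by (rule runs_mono) simp
  moreover have "represents n (\<lambda>_. 0) (initial_store n E, []) \<sigma>4"
  proof -
    have "array_tape n (\<lambda>uv. initial_store n E (0, uv)) (?f, int n)"
    proof -
      have "?f (int n + 1 + int (u * n + v)) = bit_symbol (E u v)" if uv: "u < n" "v < n" for u v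
      proof -
        \<comment> \<open>The matrix begins at position \<open>n + 1\<close>, since
          \<open>enc_unary n\<close> ends with a \<open>False\<close> at position \<open>n\<close>;
          that cell is the marker now.\<close>
        have "int n + 1 + int (u * n + v) = int (Suc n + (u * n + v))" by simp
        moreover have "?f (int (Suc n + (u * n + v))) = tape_word ?w (int (Suc n + (u * n + v)))"
          by (simp del: of_nat_add of_nat_Suc)
        moreover have "tape_word ?w (int (Suc n + (u * n + v))) = bit_symbol (E u v)"
          using enc_matrix_nth[OF uv, of E]
          unfolding tape_word_def by (simp add: enc_unary_def nth_append del: of_nat_add of_nat_Suc)
        ultimately show ?thesis by metis
      qed
      moreover have "tape_word ?w i < 3" for i by (simp add: tape_word_def bit_symbol_def)
      ultimately show ?thesis by (simp add: array_tape_def initial_store_def)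
    qed
    moreover have "array_tape n (\<lambda>uv. initial_store n E (a, uv)) (array_blank, 0)" if "a \<noteq> 0" for a
    proof -
      have "array_blank 0 = 3" "\<And>i. 0 < i \<Longrightarrow> array_blank i = 0"
        by (simp_all add: array_blank_def tape_word_def)
      then show ?thesis
        using that by (simp add: array_tape_def initial_store_def add_pos_nonneg)
    qed
    moreover have "\<sigma>4 0 = (?f, int n)" "\<sigma>4 1 = (tape_word [], 0)"
      by (simp_all add: \<sigma>4_def \<sigma>3_def S_def idx)
    moreover have "\<sigma>4 a = (array_blank, 0)" if "a \<in> {2..<11}" for a
      using that by (simp add: \<sigma>4_def del: upt_rec_numeral)
    moreover have "\<sigma>4 k = (index_tape n, 0)" if "11 \<le> k" "k < ntapes" for k
      using that by (simp add: \<sigma>4_def \<sigma>3_def idx)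
    ultimately show ?thesis
      using n unfolding represents_def arrays_def indices_def by simp
  qed
  ultimately show ?thesis by blast
qed

definition emit :: "bool list \<Rightarrow> prog" where
  "emit bs = foldr (\<lambda>b q. Put 1 (bit_symbol b) ;; Mv 1 MoveRight ;; q) bs (Mv 1 MoveStay)"

lemma runs_emit:
  assumes "\<sigma> 1 = (tape_word xs, int (length xs))"
  shows "runs (emit bs) \<sigma> (2 * length bs + 1) (\<sigma>(1 := (tape_word (xs @ bs), int (length (xs @ bs)))))"
  using assms
proof (induction bs arbitrary: xs \<sigma>)
  case Nil
  have "\<sigma>(1 := (tape_word xs, int (length xs))) = \<sigma>"
    using Nil by (metis fun_upd_triv)
  then show ?case
    using runs_Mv[of \<sigma> 1 "tape_word xs" "int (length xs)" MoveStay] Nil by (simp add: emit_def)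
next
  case (Cons b bs)
  let ?k = "int (length xs)"
  have 1: "runs (Put 1 (bit_symbol b)) \<sigma> 1 (\<sigma>(1 := (tape_word (xs @ [b]), ?k)))"
    using runs_Put[of \<sigma> 1 "tape_word xs" ?k "bit_symbol b"] Cons.prems by (simp add: tape_word_snoc)
  have 2: "runs (Mv 1 MoveRight) (\<sigma>(1 := (tape_word (xs @ [b]), ?k))) 1
      (\<sigma>(1 := (tape_word (xs @ [b]), int (length (xs @ [b])))))"
    using runs_Mv[of "\<sigma>(1 := (tape_word (xs @ [b]), ?k))" 1 _ ?k MoveRight] by (simp add: add.commute)
  have "runs (emit bs) (\<sigma>(1 := (tape_word (xs @ [b]), int (length (xs @ [b]))))) (2 * length bs + 1)
      (\<sigma>(1 := (tape_word (xs @ b # bs), int (length (xs @ b # bs)))))"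
    using Cons.IH[where xs = "xs @ [b]" and \<sigma> = "\<sigma>(1 := (tape_word (xs @ [b]), int (length (xs @ [b]))))"]
    by (simp add: fun_upd_same del: fun_upd_apply)
  from runs_Seq[OF 1 runs_Seq[OF 2 this]] show ?case by (simp add: emit_def del: fun_upd_apply)
qed

text \<open>
  Loop indices rest at position 0, which must be less than n; hence the fixed output \<open>bs\<close> for n = 0.
\<close>

definition whole :: "bool list \<Rightarrow> cmd \<Rightarrow> prog" where
  "whole bs c = Cond 0 (\<lambda>x. x = 1) (emit bs) (prepare ;; compile c)"

lemma uses_within_sequence:
  "uses_within K S (sequence p ks) \<longleftrightarrow> 1 < K \<and> (\<forall>k \<in> set ks. uses_within K S (p k))"
  by (induction ks) (auto simp: sequence_def)

lemma uses_within_compile: "wf_cmd c \<Longrightarrow> uses_within ntapes nsymbols (compile c)"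
  by (induction c)
    (auto simp: seek_def iterate_def rewind_def skip_row_def go_home_def arrays_def indices_def bit_symbol_def)

lemma uses_within_whole: "wf_cmd c \<Longrightarrow> uses_within ntapes nsymbols (whole bs c)"
proof -
  have "uses_within ntapes nsymbols (emit bs)"
    by (induction bs) (auto simp: emit_def bit_symbol_def)
  then show "uses_within ntapes nsymbols (whole bs c)" if "wf_cmd c"
    using uses_within_compile[OF that]
    by (auto simp: whole_def prepare_def uses_within_sequence index_tapes_def)
qed

text \<open>The compiler bounds the time in n, whereas \<open>FP\<close> measures it in the length
  of the encoding, which is at least n. Coefficients in the naturals make the passage
  harmless.\<close>

lemma poly_nat_mono: "x \<le> y \<Longrightarrow> poly p x \<le> poly p (y :: nat)"
  by (induction p) (auto intro: add_mono mult_le_mono)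

text \<open>The added linear polynomial covers both cases at once: \<open>2 * length bs + 1\<close>
  steps of \<open>emit\<close> if n is 0, and \<open>100 * n + 200\<close> steps of
  \<open>prepare\<close> otherwise, with one more for the initial test.\<close>

lemma whole_computes:
  assumes "wf_cmd c"
    and T: "T = poly (time c + [:2 * length bs + 300, 100:]) (length (enc_unary n @ enc_matrix n E))"
  shows "tm_computes_within (machine ntapes nsymbols (whole bs c)) (enc_unary n @ enc_matrix n E) T
    (if n = 0 then bs else snd (run n c (\<lambda>_. 0) (initial_store n E, [])))"
proof -
  let ?w = "enc_unary n @ enc_matrix n E"
  have "\<exists>\<sigma>. runs (whole bs c) (init_tapes ?w) T \<sigma> \<and>
    fst (\<sigma> 1) = tape_word (if n = 0 then bs else snd (run n c (\<lambda>_. 0) (initial_store n E, [])))"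
  proof (cases "n = 0")
    case True
    have "tape_read (init_tapes ?w 0) = 1"
      using True by (simp add: init_tapes_def tape_word_def enc_unary_def bit_symbol_def)
    then have "runs (whole bs c) (init_tapes ?w) (Suc (2 * length bs + 1))
        ((init_tapes ?w)(1 := (tape_word ([] @ bs), int (length ([] @ bs)))))"
      unfolding whole_def by (intro runs_Cond_True runs_emit) (auto simp: init_tapes_def)
    moreover have "Suc (2 * length bs + 1) \<le> T"
      by (simp add: T)
    ultimately show ?thesis using True runs_mono by fastforce
  next
    case False
    obtain \<sigma>1 where 1: "runs prepare (init_tapes ?w) (100 * n + 200) \<sigma>1"
      "represents n (\<lambda>_. 0) (initial_store n E, []) \<sigma>1"
      using prepare_correct[of n E] False by auto
    obtain \<sigma>2 where 2: "runs (compile c) \<sigma>1 (poly (time c) n) \<sigma>2"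
      "represents n (\<lambda>_. 0) (run n c (\<lambda>_. 0) (initial_store n E, [])) \<sigma>2"
      using compile_correct[OF 1(2) assms(1)] by auto
    have "tape_read (init_tapes ?w 0) \<noteq> 1"
      using False by (auto simp: init_tapes_def tape_word_def enc_unary_def bit_symbol_def nth_append)
    then have 3: "runs (whole bs c) (init_tapes ?w) (Suc (100 * n + 200 + poly (time c) n)) \<sigma>2"
      unfolding whole_def by (intro runs_Cond_False runs_Seq[OF 1(1) 2(1)]) auto
    have len: "n \<le> length ?w" by (simp add: enc_unary_def)
    have "poly (time c) n \<le> poly (time c) (length ?w)"
      by (rule poly_nat_mono[OF len])
    then have "Suc (100 * n + 200 + poly (time c) n) \<le> T"
      using len unfolding T poly_add by simp
    from runs_mono[OF 3 this] show ?thesis using False 2(2) by (auto simp: represents_def)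
  qed
  then obtain \<sigma> t where "exec (whole bs c) (init_tapes ?w) t \<sigma>" "t \<le> T"
    "fst (\<sigma> 1) = tape_word (if n = 0 then bs else snd (run n c (\<lambda>_. 0) (initial_store n E, [])))"
    unfolding runs_def by blast
  then show ?thesis using machine_computes uses_within_whole[OF assms(1)] by simp
qed

section \<open>The auction\<close>

primrec written :: "cmd \<Rightarrow> nat set" where
  "written Nop = {}"
| "written (c ; c') = written c \<union> written c'"
| "written (Write a u v x) = {a}"
| "written (If a u v x c c') = written c \<union> written c'"
| "written (For u c) = written c"
| "written (Out b) = {}"

primrec silent :: "cmd \<Rightarrow> bool" where
  "silent Nop \<longleftrightarrow> True"
| "silent (c ; c') \<longleftrightarrow> silent c \<and> silent c'"
| "silent (Write a u v x) \<longleftrightarrow> True"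
| "silent (If a u v x c c') \<longleftrightarrow> silent c \<and> silent c'"
| "silent (For u c) \<longleftrightarrow> silent c"
| "silent (Out b) \<longleftrightarrow> False"

lemma fold_invariant:
  assumes "I 0 s" "\<And>i s. i < n \<Longrightarrow> I i s \<Longrightarrow> I (Suc i) (f i s)"
  shows "I n (fold f [0..<n] s)"
  using assms by (induction n) auto

lemma run_For_invariant:
  assumes "I 0 s" "\<And>i s. i < n \<Longrightarrow> I i s \<Longrightarrow> I (Suc i) (run n c (\<rho>(u := i)) s)"
  shows "I n (run n (For u c) \<rho> s)"
  using fold_invariant[of I s n] assms by simp

text \<open>Each array serves one purpose, so most facts survive a command simply because it does
  not write to their array.\<close>

lemma run_frame: "a \<notin> written c \<Longrightarrow> fst (run n c \<rho> s) (a, uv) = fst s (a, uv)"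
proof (induction c arbitrary: \<rho> s)
  case (For u c)
  show ?case
    by (rule run_For_invariant[where I = "\<lambda>_ s'. fst s' (a, uv) = fst s (a, uv)"]) (use For in auto)
qed auto

lemma run_silent: "silent c \<Longrightarrow> snd (run n c \<rho> s) = snd s"
proof (induction c arbitrary: \<rho> s)
  case (For u c)
  show ?case
    by (rule run_For_invariant[where I = "\<lambda>_ s'. snd s' = snd s"]) (use For in auto)
qed auto

lemma run_For_output:
  assumes "\<And>i out. i < n \<Longrightarrow> run n c (\<rho>(u := i)) (st, out) = (st, out @ g i)"
  shows "run n (For u c) \<rho> (st, out) = (st, out @ concat (map g [0..<n]))"
  by (rule run_For_invariant[where I = "\<lambda>i s. s = (st, out @ concat (map g [0..<i]))"])
    (auto simp: assms)

text \<open>Row j of \<open>Price\<close> is the price of item j in unary; \<open>Match\<close> has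
  a 1 at (i, j) if i owns item j. \<open>Vis\<close> is 0 for a vertex not yet on the tour, 1 for
  the current one and 2 for the earlier ones; \<open>Ord\<close> has a 1 at (t, v) if v is vertex
  number t of the tour. \<open>New\<close> is the adjacency matrix of the output. \<open>Vis\<close>
  and \<open>Mark\<close> use column 0, \<open>Flag\<close> and \<open>Ok\<close> a single cell. No
  loop runs over \<open>iz\<close>, so it denotes the constant index 0.\<close>

abbreviation (input) "Adj \<equiv> 0 :: nat"
abbreviation (input) "Below \<equiv> 2 :: nat"
abbreviation (input) "Price \<equiv> 3 :: nat"
abbreviation (input) "Match \<equiv> 4 :: nat"
abbreviation (input) "Flag \<equiv> 5 :: nat"
abbreviation (input) "Ok \<equiv> 6 :: nat"
abbreviation (input) "Mark \<equiv> 7 :: nat"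
abbreviation (input) "Vis \<equiv> 8 :: nat"
abbreviation (input) "Ord \<equiv> 9 :: nat"
abbreviation (input) "New \<equiv> 10 :: nat"
abbreviation (input) "iz \<equiv> 12 :: nat"
abbreviation (input) "ii \<equiv> 13 :: nat"
abbreviation (input) "ij \<equiv> 14 :: nat"
abbreviation (input) "ik \<equiv> 15 :: nat"
abbreviation (input) "iw \<equiv> 16 :: nat"
abbreviation (input) "ix \<equiv> 17 :: nat"
abbreviation (input) "iy \<equiv> 18 :: nat"

definition has_edges :: "nat \<Rightarrow> (nat \<Rightarrow> nat \<Rightarrow> bool) \<Rightarrow> store \<Rightarrow> bool" where
  "has_edges n E st \<longleftrightarrow> (\<forall>u < n. \<forall>v < n. st (Adj, u, v) = bit_symbol (E u v))"

definition scan :: cmd where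
  "scan = Write Flag iz iz 0 ; For ij (If Match ii ij 1 (Write Flag iz iz 1) Nop)"

text \<open>It is called with \<open>ik\<close> at the present price of \<open>ij\<close>, so the
  write fills the first zero of the unary row and raises the price by one. Clearing the column
  evicts the previous owner, and the flag ends the search.\<close>

definition purchase :: cmd where
  "purchase =
     Write Flag iz iz 1 ; Write Price ij ik 1 ; For iw (Write Match iw ij 0) ; Write Match ii ij 1"

text \<open>Row j of \<open>Price\<close> has a zero at k iff the price of j is at most k. With the
  price level in the outer loop, the first hit is a cheapest neighbour; levels stay below n, so an
  item of price n is no longer for sale.\<close>

definition search :: cmd where
  "search =
     For ik (For ij (If Flag iz iz 0 (If Adj ii ij 2 (If Price ij ik 0 purchase Nop) Nop) Nop))"

definition bid :: cmd where
  "bid = scan ; search"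

text \<open>The two outer loops only count: n * n rounds are as many as the sum of n prices of at
  most n can grow.\<close>

definition auction :: cmd where
  "auction = For ix (For iy (For ii bid))"

lemma run_scan:
  assumes "\<rho> iz = 0"
  shows "run n scan \<rho> s = ((fst s)((Flag, 0, 0) := if \<exists>j < n. fst s (Match, \<rho> ii, j) = 1 then 1 else 0), snd s)"
proof -
  let ?I = "\<lambda>j s'. s' = ((fst s)((Flag, 0, 0) := if \<exists>j' < j. fst s (Match, \<rho> ii, j') = 1 then 1 else 0), snd s)"
  have "?I n (run n (For ij (If Match ii ij 1 (Write Flag iz iz 1) Nop)) \<rho> ((fst s)((Flag, 0, 0) := 0), snd s))"
    by (rule run_For_invariant[where I = ?I])
      (use assms in \<open>auto simp: less_Suc_eq fun_eq_iff\<close>)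
  then show ?thesis using assms by (simp add: scan_def)
qed

definition purchased :: "nat \<Rightarrow> nat \<Rightarrow> nat \<Rightarrow> nat \<Rightarrow> store \<Rightarrow> store" where
  "purchased n i j k st = (\<lambda>(a, u, v).
     if a = Flag \<and> u = 0 \<and> v = 0 then 1
     else if a = Price \<and> u = j \<and> v = k then 1
     else if a = Match \<and> u < n \<and> v = j then (if u = i then 1 else 0)
     else st (a, u, v))"

lemma run_clear:
  "run n (For iw (Write Match iw ij 0)) \<rho> s =
    ((\<lambda>(a, u, v). if a = Match \<and> u < n \<and> v = \<rho> ij then 0 else fst s (a, u, v)), snd s)"
proof -
  let ?I = "\<lambda>w s'. s' = ((\<lambda>(a, u, v). if a = Match \<and> u < w \<and> v = \<rho> ij then 0 else fst s (a, u, v)), snd s)"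
  show ?thesis
    by (rule run_For_invariant[where I = ?I]) (auto simp: less_Suc_eq fun_eq_iff)
qed

lemma run_purchase:
  assumes "\<rho> iz = 0" "\<rho> ii < n"
  shows "run n purchase \<rho> s = (purchased n (\<rho> ii) (\<rho> ij) (\<rho> ik) (fst s), snd s)"
  using assms unfolding purchase_def run.simps(2) run_clear
  by (auto simp: purchased_def fun_eq_iff)

lemma run_search_flagged:
  assumes "\<rho> iz = 0" "fst s (Flag, 0, 0) \<noteq> 0"
  shows "run n search \<rho> s = s"
  unfolding search_def
proof (rule run_For_invariant[where I = "\<lambda>_ s'. s' = s"])
  fix k s' assume "s' = s"
  then show "run n (For ij (If Flag iz iz 0 (If Adj ii ij 2 (If Price ij ik 0 purchase Nop) Nop) Nop))
      (\<rho>(ik := k)) s' = s"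
    by (intro run_For_invariant[where I = "\<lambda>_ s'. s' = s"]) (use assms in auto)
qed simp

text \<open>The minimality of the level \<open>k\<close> is recorded because the price invariant
  rests on the item being a cheapest one.\<close>

lemma run_search:
  assumes \<rho>: "\<rho> iz = 0" "\<rho> ii < n" and flag: "fst s (Flag, 0, 0) = 0"
  defines "cand \<equiv> \<lambda>k j. fst s (Adj, \<rho> ii, j) = 2 \<and> fst s (Price, j, k) = 0"
  shows "(run n search \<rho> s = s \<and> (\<forall>k < n. \<forall>j < n. \<not> cand k j)) \<or>
    (\<exists>k < n. \<exists>j < n. cand k j \<and> (\<forall>k' < k. \<forall>j' < n. \<not> cand k' j') \<and>
      run n search \<rho> s = (purchased n (\<rho> ii) j k (fst s), snd s))"
proof -
  define found where "found s' \<longleftrightarrow> (\<exists>k < n. \<exists>j < n. cand k j \<and> (\<forall>k' < k. \<forall>j' < n. \<not> cand k' j') \<and>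
      s' = (purchased n (\<rho> ii) j k (fst s), snd s))" for s'
  have flag': "fst s' (Flag, 0, 0) = 1" if "found s'" for s'
    using that by (auto simp: found_def purchased_def)
  let ?c = "If Flag iz iz 0 (If Adj ii ij 2 (If Price ij ik 0 purchase Nop) Nop) Nop"
  let ?I = "\<lambda>k s'. (s' = s \<and> (\<forall>k' < k. \<forall>j < n. \<not> cand k' j)) \<or> found s'"
  have "?I n (run n search \<rho> s)"
    unfolding search_def
  proof (rule run_For_invariant[where I = ?I])
    fix k s' assume k: "k < n" and I: "?I k s'"
    show "?I (Suc k) (run n (For ij ?c) (\<rho>(ik := k)) s')"
    proof (cases "found s'")
      case True
      have "run n (For ij ?c) (\<rho>(ik := k)) s' = s'"
        by (rule run_For_invariant[where I = "\<lambda>_ s''. s'' = s'"]) (use \<rho> flag'[OF True] in auto)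
      then show ?thesis using True by simp
    next
      case False
      then have s': "s' = s" and none: "\<forall>k' < k. \<forall>j < n. \<not> cand k' j" using I by auto
      let ?J = "\<lambda>j s'. (s' = s \<and> (\<forall>j' < j. \<not> cand k j')) \<or> found s'"
      have "?J n (run n (For ij ?c) (\<rho>(ik := k)) s')"
      proof (rule run_For_invariant[where I = ?J])
        fix j s'' assume j: "j < n" and J: "?J j s''"
        let ?\<rho> = "\<rho>(ik := k, ij := j)"
        show "?J (Suc j) (run n ?c ?\<rho> s'')"
        proof (cases "found s''")
          case True
          then show ?thesis using flag'[OF True] \<rho> by simp
        next
          case False
          then have s'': "s'' = s" and none': "\<forall>j' < j. \<not> cand k j'" using J by auto
          show ?thesis
          proof (cases "cand k j")
            case True
            then have "run n ?c ?\<rho> s'' = run n purchase ?\<rho> s''"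
              using \<rho> flag unfolding s'' by (simp add: cand_def)
            also have "\<dots> = (purchased n (\<rho> ii) j k (fst s), snd s)"
              using run_purchase[of ?\<rho> n s''] \<rho> unfolding s'' by simp
            finally have "found (run n ?c ?\<rho> s'')"
              unfolding found_def using True k j none by blast
            then show ?thesis by simp
          next
            case False
            then have "run n ?c ?\<rho> s'' = s"
              using \<rho> flag unfolding s'' by (auto simp: cand_def)
            then show ?thesis using False none' by (auto simp: less_Suc_eq)
          qed
        qed
      qed (use s' in simp)
      then show ?thesis using none by (auto simp: less_Suc_eq)
    qed
  qed simp
  then show ?thesis unfolding found_def by blast
qed

definition auction_state :: "nat \<Rightarrow> store \<Rightarrow> (nat \<Rightarrow> nat) \<Rightarrow> (nat \<Rightarrow> nat option) \<Rightarrow> bool" where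
  "auction_state n st p own \<longleftrightarrow>
     (\<forall>j < n. \<forall>k < n. st (Price, j, k) = (if k < p j then 1 else 0)) \<and>
     (\<forall>i < n. \<forall>j < n. st (Match, i, j) = (if own j = Some i then 1 else 0))"

text \<open>The second line is complementary slackness with increment 1, known from auction
  algorithms. It holds right after a purchase at the cheapest price and persists because prices
  never fall. An item once sold always keeps some owner, so the unowned items are those of price
  0.\<close>

definition auction_inv ::
  "nat \<Rightarrow> (nat \<Rightarrow> nat \<Rightarrow> bool) \<Rightarrow> (nat \<Rightarrow> nat) \<Rightarrow> (nat \<Rightarrow> nat option) \<Rightarrow> bool"
where
  "auction_inv n E p own \<longleftrightarrow>
     (\<forall>j < n. p j \<le> n \<and> (own j = None \<longleftrightarrow> p j = 0)) \<and>
     (\<forall>j < n. \<forall>i. own j = Some i \<longrightarrow> i < n \<and> E i j \<and> (\<forall>j' < n. E i j' \<longrightarrow> p j \<le> Suc (p j'))) \<and>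
     (\<forall>j < n. \<forall>j' < n. own j = own j' \<and> own j \<noteq> None \<longrightarrow> j = j')"

definition assigned :: "nat \<Rightarrow> (nat \<Rightarrow> nat option) \<Rightarrow> nat \<Rightarrow> bool" where
  "assigned n own i \<longleftrightarrow> (\<exists>j < n. own j = Some i)"

definition priced_out :: "nat \<Rightarrow> (nat \<Rightarrow> nat \<Rightarrow> bool) \<Rightarrow> (nat \<Rightarrow> nat) \<Rightarrow> nat \<Rightarrow> bool" where
  "priced_out n E p i \<longleftrightarrow> (\<forall>j < n. E i j \<longrightarrow> n \<le> p j)"

lemma run_bid:
  assumes \<rho>: "\<rho> iz = 0" "\<rho> ii = i" "i < n"
    and st: "auction_state n (fst s) p own" "auction_inv n E p own" "has_edges n E (fst s)"
  shows "\<exists>p' own'. auction_state n (fst (run n bid \<rho> s)) p' own' \<and> auction_inv n E p' own' \<and>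
    (p' = p \<and> own' = own \<and> (assigned n own i \<or> priced_out n E p i) \<or>
     \<not> assigned n own i \<and> \<not> priced_out n E p i \<and> (\<Sum>j<n. p' j) = Suc (\<Sum>j<n. p j))"
proof -
  let ?a = "\<exists>j < n. fst s (Match, i, j) = 1"
  let ?s = "((fst s)((Flag, 0, 0) := if ?a then 1 else 0), snd s)"
  have run: "run n bid \<rho> s = run n search \<rho> ?s"
    using run_scan[of \<rho> n s] \<rho> by (simp add: bid_def)
  have a: "?a \<longleftrightarrow> assigned n own i"
  proof -
    have "fst s (Match, i, j) = 1 \<longleftrightarrow> own j = Some i" if "j < n" for j
      using st(1) \<rho>(3) that by (simp add: auction_state_def)
    then show ?thesis by (auto simp: assigned_def)
  qed
  have st': "auction_state n (fst ?s) p own"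
    using st(1) by (simp add: auction_state_def)
  have adj: "fst ?s (Adj, i, j) = 2 \<longleftrightarrow> E i j" if "j < n" for j
    using st(3) \<rho>(3) that by (simp add: has_edges_def bit_symbol_def)
  have price: "fst ?s (Price, j, k) = 0 \<longleftrightarrow> p j \<le> k" if "j < n" "k < n" for j k
    using st(1) that by (auto simp: auction_state_def)
  show ?thesis
  proof (cases ?a)
    case True
    then have "run n bid \<rho> s = ?s"
      using run run_search_flagged[of \<rho> ?s n] \<rho> by simp
    then show ?thesis using a True st(2) st' by auto
  next
    case False
    have "\<rho> ii < n" "fst ?s (Flag, 0, 0) = 0" using False \<rho> by simp_all
    from run_search[OF \<rho>(1) this] show ?thesis
      unfolding \<rho>(2)
    proof (elim disjE exE conjE)
      assume 1: "run n search \<rho> ?s = ?s"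
        and "\<forall>k < n. \<forall>j < n. \<not> (fst ?s (Adj, i, j) = 2 \<and> fst ?s (Price, j, k) = 0)"
      then have none: "\<forall>k < n. \<forall>j < n. \<not> (E i j \<and> p j \<le> k)"
        using adj price by blast
      have "priced_out n E p i"
        unfolding priced_out_def using none by (metis leI order_refl)
      then show ?thesis using run 1 st' st(2) by metis
    next
      fix k j assume k: "k < n" and j: "j < n"
        and cand: "fst ?s (Adj, i, j) = 2" "fst ?s (Price, j, k) = 0"
        and none: "\<forall>k' < k. \<forall>j' < n. \<not> (fst ?s (Adj, i, j') = 2 \<and> fst ?s (Price, j', k') = 0)"
        and 1: "run n search \<rho> ?s = (purchased n i j k (fst ?s), snd ?s)"
      note j = j cand[unfolded adj[OF j] price[OF j k]]
      have first: "\<forall>k' < k. \<forall>j' < n. \<not> (E i j' \<and> p j' \<le> k')"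
        using none adj price k less_trans by blast
      have min: "k \<le> p j'" if "j' < n" "E i j'" for j'
        using first that by (metis leI order_refl)
      \<comment> \<open>The hit bounds the price of \<open>j\<close> by \<open>k\<close> from above,
        and no neighbour of \<open>i\<close> is cheaper than \<open>k\<close>; thus setting bit
        \<open>k\<close> is an increment by exactly one.\<close>
      then have pj: "p j = k" using j by (simp add: le_antisym)
      let ?p = "p(j := Suc k)" and ?own = "own(j := Some i)"
      have "auction_state n (purchased n i j k (fst ?s)) ?p ?own"
        using st' j k pj by (auto simp: auction_state_def purchased_def less_Suc_eq)
      moreover have "auction_inv n E ?p ?own"
      proof -
        \<comment> \<open>The bidder owned nothing, so giving it \<open>j\<close> keeps ownership
          injective.\<close>
        have no: "own j' \<noteq> Some i" if "j' < n" for j'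
          using False a that by (auto simp: assigned_def)
        have 1: "\<forall>j' < n. p j' \<le> n \<and> (own j' = None \<longleftrightarrow> p j' = 0)"
          and 2: "\<And>j' i'. j' < n \<Longrightarrow> own j' = Some i' \<Longrightarrow>
            i' < n \<and> E i' j' \<and> (\<forall>j'' < n. E i' j'' \<longrightarrow> p j' \<le> Suc (p j''))"
          and 3: "\<And>j' j''. j' < n \<Longrightarrow> j'' < n \<Longrightarrow> own j' = own j'' \<Longrightarrow> own j' \<noteq> None \<Longrightarrow> j' = j''"
          using st(2) unfolding auction_inv_def by blast+
        have le: "p j' \<le> ?p j'" for j' using pj by simp
        have "\<forall>j' < n. ?p j' \<le> n \<and> (?own j' = None \<longleftrightarrow> ?p j' = 0)"
          using 1 k by simp
        moreover have "i' < n \<and> E i' j' \<and> (\<forall>j'' < n. E i' j'' \<longrightarrow> ?p j' \<le> Suc (?p j''))"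
          if "j' < n" "?own j' = Some i'" for j' i'
        proof (cases "j' = j")
          case True
          then show ?thesis using that(2) \<rho>(3) j(2) min le by (auto intro: le_trans)
        next
          case False
          then have "own j' = Some i'" using that(2) by simp
          note j' = 2[OF that(1) this]
          have "p j' \<le> Suc (?p j'')" if "j'' < n" "E i' j''" for j''
            using j' that le[of j''] by (meson Suc_le_mono le_trans)
          then show ?thesis using j' False by simp
        qed
        moreover have "j' = j''" if "j' < n" "j'' < n" "?own j' = ?own j''" "?own j' \<noteq> None" for j' j''
          using 3[OF that(1,2)] that no[OF that(1)] no[OF that(2)] by (auto split: if_splits)
        ultimately show ?thesis unfolding auction_inv_def by blast
      qed
      moreover have "(\<Sum>j<n. ?p j) = Suc (\<Sum>j<n. p j)"
      proof -
        have "(\<Sum>j'<n. ?p j') = ?p j + (\<Sum>j' \<in> {..<n} - {j}. ?p j')"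
          using j(1) by (simp add: sum.remove)
        moreover have "(\<Sum>j'<n. p j') = p j + (\<Sum>j' \<in> {..<n} - {j}. p j')"
          using j(1) by (simp add: sum.remove)
        moreover have "(\<Sum>j' \<in> {..<n} - {j}. ?p j') = (\<Sum>j' \<in> {..<n} - {j}. p j')"
          by (rule sum.cong) auto
        ultimately show ?thesis using pj by simp
      qed
      moreover have "\<not> priced_out n E p i" using j k pj by (auto simp: priced_out_def)
      ultimately show ?thesis using run 1 a False by fastforce
    qed
  qed
qed

definition settled ::
  "nat \<Rightarrow> (nat \<Rightarrow> nat \<Rightarrow> bool) \<Rightarrow> (nat \<Rightarrow> nat) \<Rightarrow> (nat \<Rightarrow> nat option) \<Rightarrow> bool"
where
  "settled n E p own \<longleftrightarrow> (\<forall>i < n. assigned n own i \<or> priced_out n E p i)"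

definition auction_ok ::
  "nat \<Rightarrow> (nat \<Rightarrow> nat \<Rightarrow> bool) \<Rightarrow> store \<Rightarrow> (nat \<Rightarrow> nat) \<Rightarrow> (nat \<Rightarrow> nat option) \<Rightarrow> bool"
where
  "auction_ok n E st p own \<longleftrightarrow>
     auction_state n st p own \<and> auction_inv n E p own \<and> has_edges n E st"

text \<open>A bid without effect shows that its vertex owns an item or is priced out. If no bid has
  an effect, this holds for all vertices with the same prices; otherwise the sum of the prices has
  grown, as no bid lowers it.\<close>

lemma run_round:
  assumes \<rho>: "\<rho> iz = 0" and ok: "auction_ok n E (fst s) p own"
  shows "\<exists>p' own'. auction_ok n E (fst (run n (For ii bid) \<rho> s)) p' own' \<and>
    (settled n E p' own' \<or> \<not> settled n E p own \<and> (\<Sum>j<n. p j) < (\<Sum>j<n. p' j))"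
proof -
  let ?I = "\<lambda>i (s' :: store \<times> bool list). \<exists>p' own'. auction_ok n E (fst s') p' own' \<and>
    (p' = p \<and> own' = own \<and> (\<forall>i' < i. assigned n own i' \<or> priced_out n E p i') \<or>
     \<not> settled n E p own \<and> (\<Sum>j<n. p j) < (\<Sum>j<n. p' j))"
  have "?I n (run n (For ii bid) \<rho> s)"
  proof (rule run_For_invariant[where I = ?I])
    fix i s' assume i: "i < n" and "?I i s'"
    then obtain p1 own1 where 1: "auction_ok n E (fst s') p1 own1"
      "p1 = p \<and> own1 = own \<and> (\<forall>i' < i. assigned n own i' \<or> priced_out n E p i') \<or>
       \<not> settled n E p own \<and> (\<Sum>j<n. p j) < (\<Sum>j<n. p1 j)" by blast
    let ?s = "run n bid (\<rho>(ii := i)) s'"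
    obtain p2 own2 where 2: "auction_state n (fst ?s) p2 own2" "auction_inv n E p2 own2"
      "p2 = p1 \<and> own2 = own1 \<and> (assigned n own1 i \<or> priced_out n E p1 i) \<or>
       \<not> assigned n own1 i \<and> \<not> priced_out n E p1 i \<and> (\<Sum>j<n. p2 j) = Suc (\<Sum>j<n. p1 j)"
      using run_bid[of "\<rho>(ii := i)" i n s' p1 own1 E] \<rho> i 1(1) unfolding auction_ok_def by auto
    have "fst ?s (Adj, uv) = fst s' (Adj, uv)" for uv
      by (rule run_frame) (simp add: bid_def scan_def search_def purchase_def)
    then have "auction_ok n E (fst ?s) p2 own2"
      using 1(1) 2 by (simp add: auction_ok_def has_edges_def)
    moreover have "p2 = p \<and> own2 = own \<and> (\<forall>i' < Suc i. assigned n own i' \<or> priced_out n E p i') \<or>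
       \<not> settled n E p own \<and> (\<Sum>j<n. p j) < (\<Sum>j<n. p2 j)"
      using 1(2) 2(3) i by (auto simp: less_Suc_eq settled_def)
    ultimately show "?I (Suc i) ?s" by blast
  qed (use ok in auto)
  then show ?thesis unfolding settled_def by blast
qed

lemma run_auction:
  assumes \<rho>: "\<rho> iz = 0" and ok: "auction_ok n E (fst s) p own"
  shows "\<exists>p' own'. auction_ok n E (fst (run n auction \<rho> s)) p' own' \<and> settled n E p' own'"
proof -
  let ?I = "\<lambda>m (s' :: store \<times> bool list). \<exists>p' own'. auction_ok n E (fst s') p' own' \<and>
    (settled n E p' own' \<or> m \<le> (\<Sum>j<n. p' j))"
  have "?I (n * n) (run n auction \<rho> s)"
    unfolding auction_def
  proof (rule run_For_invariant[where I = "\<lambda>x. ?I (x * n)"])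
    fix x s' assume x: "x < n" "?I (x * n) s'"
    have "?I (x * n + n) (run n (For iy (For ii bid)) (\<rho>(ix := x)) s')"
    proof (rule run_For_invariant[where I = "\<lambda>y. ?I (x * n + y)"])
      fix y s'' assume "?I (x * n + y) s''"
      then obtain p1 own1 where 1: "auction_ok n E (fst s'') p1 own1"
        "settled n E p1 own1 \<or> x * n + y \<le> (\<Sum>j<n. p1 j)" by blast
      show "?I (x * n + Suc y) (run n (For ii bid) (\<rho>(ix := x, iy := y)) s'')"
        using run_round[of "\<rho>(ix := x, iy := y)" n E s'' p1 own1] \<rho> 1 by fastforce
    qed (use x in simp)
    then show "?I (Suc x * n) (run n (For iy (For ii bid)) (\<rho>(ix := x)) s')"
      by (simp add: add.commute)
  qed (use ok in auto)
  then obtain p' own' where 1: "auction_ok n E (fst (run n auction \<rho> s)) p' own'"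
    "settled n E p' own' \<or> n * n \<le> (\<Sum>j<n. p' j)" by blast
  \<comment> \<open>If the sum has reached n * n, then every price is n, since none exceeds it. All
    vertices are then priced out, and the state is settled in this case too.\<close>
  have "n \<le> p' j" if "n * n \<le> (\<Sum>j<n. p' j)" "j < n" for j
  proof (rule ccontr)
    assume "\<not> n \<le> p' j"
    then have "(\<Sum>j<n. p' j) < (\<Sum>j<n. n)"
      using 1(1) that(2)
      by (intro sum_strict_mono_ex1) (auto simp: auction_ok_def auction_inv_def intro: bexI[of _ j])
    then show False using that(1) by simp
  qed
  then show ?thesis using 1 by (auto simp: settled_def priced_out_def)
qed

text \<open>
  Some price t between 1 and n occurs nowhere, since less than n items are owned. The owners of the
  items of price above t, together with the unassigned i, have all their neighbours among these items.
\<close>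

lemma no_matching_if_priced_out:
  assumes inv: "auction_inv n E p own" and i: "i < n" "\<not> assigned n own i" "priced_out n E p i"
    and f: "inj_on f {..<n}" "\<And>i. i < n \<Longrightarrow> f i < n \<and> E i (f i)"
  shows False
proof -
  let ?D = "\<lambda>t. {j. j < n \<and> t \<le> p j}"
  define owner where "owner j = the (own j)" for j
  have own: "own j = Some (owner j)" if "j \<in> ?D 1" for j
    using that inv by (auto simp: auction_inv_def owner_def)
  have owner: "owner j < n" "owner j \<noteq> i" "E (owner j) j'\<Longrightarrow> j' < n \<Longrightarrow> p j \<le> Suc (p j')"
    if "j \<in> ?D 1" for j j'
    using own[OF that] that inv i(2) by (auto simp: auction_inv_def assigned_def)
  have inj: "inj_on owner (?D 1)"
  proof (rule inj_onI)
    fix j j' assume jj: "j \<in> ?D 1" "j' \<in> ?D 1" "owner j = owner j'"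
    then have "own j = own j'" "own j \<noteq> None" using own by auto
    then show "j = j'" using inv jj by (auto simp: auction_inv_def)
  qed
  have "owner ` ?D 1 \<subseteq> {..<n} - {i}" using owner by auto
  then have "card (owner ` ?D 1) \<le> card ({..<n} - {i})"
    by (intro card_mono) auto
  then have "card (?D 1) \<le> card ({..<n} - {i})"
    unfolding card_image[OF inj] .
  also have "\<dots> < n" using i(1) by simp
  finally have "card (p ` ?D 1) < card {1..n}"
    using card_image_le[of "?D 1" p] by simp
  then have "\<not> {1..n} \<subseteq> p ` ?D 1"
    using card_mono[of "p ` ?D 1" "{1..n}"] by auto
  then obtain t where t: "1 \<le> t" "t \<le> n" "\<And>j. j < n \<Longrightarrow> p j \<noteq> t" by force
  have sub: "?D t \<subseteq> ?D 1" using t(1) by auto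
  let ?X = "insert i (owner ` ?D t)"
  have "f ` ?X \<subseteq> ?D t"
  proof (intro image_subsetI)
    fix i' assume "i' \<in> ?X"
    then consider "i' = i" | j where "j \<in> ?D t" "i' = owner j" by blast
    then show "f i' \<in> ?D t"
    proof cases
      case 1
      then show ?thesis using f(2)[OF i(1)] i(3) t(2) by (auto simp: priced_out_def)
    next
      case 2
      then have "p j \<le> Suc (p (f i'))" using owner[of j] f(2)[of i'] sub by blast
      \<comment> \<open>The gap at \<open>t\<close> compensates the slack of one in the invariant: a
        price of at least \<open>t\<close> is above \<open>t\<close>, so every neighbour of the
        owner costs at least \<open>t\<close>.\<close>
      moreover have "t < p j" using 2(1) t(3)[of j] by (simp add: le_neq_implies_less)
      ultimately show ?thesis using f(2)[of i'] owner(1)[of j] 2 sub by auto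
    qed
  qed
  moreover have "?X \<subseteq> {..<n}" using i(1) owner(1) sub by auto
  ultimately have "card ?X \<le> card (?D t)"
    using card_image[OF inj_on_subset[OF f(1)], of ?X] card_mono[of "?D t" "f ` ?X"] by simp
  \<comment> \<open>This violates Hall's condition: the owners and \<open>i\<close> are one more
    than the items that contain all their neighbours.\<close>
  moreover have "card ?X = Suc (card (?D t))"
    using owner(2) sub card_image[OF inj_on_subset[OF inj sub]]
    by (subst card_insert_disjoint) auto
  ultimately show False by simp
qed

section \<open>Linking the cycles\<close>

text \<open>For loops whose acting rounds all lead to the same state \<open>s1\<close>, also when
  started in \<open>s1\<close>; nested loops can be treated by repeated use.\<close>

lemma run_For_mark:
  assumes "\<And>i s. i < n \<Longrightarrow> s = s0 \<or> s = s1 \<Longrightarrow> run n c (\<rho>(u := i)) s = (if Q i then s1 else s)"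
    and "s = s0 \<or> s = s1"
  shows "run n (For u c) \<rho> s = (if \<exists>i < n. Q i then s1 else s)"
proof -
  let ?I = "\<lambda>i s'. s' = (if \<exists>i' < i. Q i' then s1 else s)"
  show ?thesis
  proof (rule run_For_invariant[where I = ?I])
    fix i s' assume i: "i < n" and s': "?I i s'"
    then have "run n c (\<rho>(u := i)) s' = (if Q i then s1 else s')"
      using assms(2) by (intro assms(1)) auto
    then show "?I (Suc i) (run n c (\<rho>(u := i)) s')" using s' by (auto simp: less_Suc_eq)
  qed simp
qed

lemma run_For_unchanged:
  assumes "\<And>i. i < n \<Longrightarrow> run n c (\<rho>(u := i)) s = s"
  shows "run n (For u c) \<rho> s = s"
  by (rule run_For_invariant[where I = "\<lambda>_ s'. s' = s"]) (use assms in auto)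

text \<open>For guarded searches: \<open>D\<close> describes success, including the set flag, and
  makes all later rounds idle. Without success the loop certifies that nothing satisfies
  \<open>Q\<close>.\<close>

lemma run_For_search:
  assumes "\<And>i. i < n \<Longrightarrow> run n c (\<rho>(u := i)) s = s \<and> \<not> Q i \<or> D (run n c (\<rho>(u := i)) s)"
    and "\<And>i s. i < n \<Longrightarrow> D s \<Longrightarrow> run n c (\<rho>(u := i)) s = s"
  shows "run n (For u c) \<rho> s = s \<and> (\<forall>i < n. \<not> Q i) \<or> D (run n (For u c) \<rho> s)"
proof -
  let ?I = "\<lambda>i s'. s' = s \<and> (\<forall>i' < i. \<not> Q i') \<or> D s'"
  have "?I n (run n (For u c) \<rho> s)"
  proof (rule run_For_invariant[where I = ?I])
    fix i s' assume "i < n" "?I i s'"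
    then show "?I (Suc i) (run n c (\<rho>(u := i)) s')"
      using assms(1)[of i] assms(2)[of i s'] by (auto simp: less_Suc_eq)
  qed simp
  then show ?thesis .
qed

text \<open>The order of the indices is read off from the order of the loop: when it arrives at k,
  exactly the smaller indices have been marked.\<close>

definition compare :: cmd where
  "compare = For ik (For iw (If Mark iw iz 1 (Write Below iw ik 1) Nop) ; Write Mark ik iz 1)"

lemma run_compare:
  assumes \<rho>: "\<rho> iz = 0"
    and "\<And>u v. fst s (Mark, u, v) = 0" "\<And>u v. fst s (Below, u, v) = 0"
  shows "\<forall>u < n. \<forall>v < n. fst (run n compare \<rho> s) (Below, u, v) = (if u < v then 1 else 0)"
proof -
  let ?I = "\<lambda>k (s' :: store \<times> bool list).
    (\<forall>u < n. fst s' (Mark, u, 0) = (if u < k then 1 else 0)) \<and>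
    (\<forall>u < n. \<forall>v < n. fst s' (Below, u, v) = (if u < v \<and> v < k then 1 else 0))"
  have "?I n (run n compare \<rho> s)"
    unfolding compare_def
  proof (rule run_For_invariant[where I = ?I])
    fix k s' assume k: "k < n" and I: "?I k s'"
    let ?J = "\<lambda>w s''. s'' = ((\<lambda>(a, u, v).
      if a = Below \<and> v = k \<and> u < w \<and> fst s' (Mark, u, 0) = 1 then 1 else fst s' (a, u, v)), snd s')"
    have "?J n (run n (For iw (If Mark iw iz 1 (Write Below iw ik 1) Nop)) (\<rho>(ik := k)) s')"
      by (rule run_For_invariant[where I = ?J])
        (use \<rho> in \<open>auto simp: less_Suc_eq fun_eq_iff\<close>)
    then show "?I (Suc k) (run n (For iw (If Mark iw iz 1 (Write Below iw ik 1) Nop) ; Write Mark ik iz 1)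
        (\<rho>(ik := k)) s')"
      using I k \<rho> by (auto simp del: run.simps(5) simp: less_Suc_eq)
  qed (use assms in simp)
  then show ?thesis by auto
qed

text \<open>A chain of three indices below n exists iff n is at least 3, the least length of a
  cycle.\<close>

definition check_size :: cmd where
  "check_size =
     For ii (For ij (For ik (If Below ii ij 1 (If Below ij ik 1 (Write Ok iz iz 1) Nop) Nop)))"

lemma run_check_size:
  assumes \<rho>: "\<rho> iz = 0"
    and below: "\<forall>u < n. \<forall>v < n. fst s (Below, u, v) = (if u < v then 1 else 0)"
    and ok: "fst s (Ok, 0, 0) = 0"
  shows "fst (run n check_size \<rho> s) (Ok, 0, 0) = (if 3 \<le> n then 1 else 0)"
proof -
  let ?s1 = "((fst s)((Ok, 0, 0) := 1), snd s)"
  have "run n check_size \<rho> s = (if \<exists>i < n. \<exists>j < n. \<exists>k < n. i < j \<and> j < k then ?s1 else s)"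
    unfolding check_size_def
    by (rule run_For_mark[where ?s0.0 = s and ?s1.0 = ?s1], rule run_For_mark[where ?s0.0 = s and ?s1.0 = ?s1],
        rule run_For_mark[where ?s0.0 = s and ?s1.0 = ?s1])
      (use \<rho> below in auto)
  moreover have "(\<exists>i < n. \<exists>j < n. \<exists>k < n. i < j \<and> j < k) \<longleftrightarrow> 3 \<le> n"
  proof
    assume "3 \<le> n"
    then show "\<exists>i < n. \<exists>j < n. \<exists>k < n. i < j \<and> j < k"
      by (intro exI[of _ 0] exI[of _ 1] exI[of _ 2] conjI) auto
  qed auto
  ultimately show ?thesis using ok by simp
qed

definition check_matching :: cmd where
  "check_matching = For ii (scan ; If Flag iz iz 0 (Write Ok iz iz 0) Nop)"

lemma run_check_matching:
  assumes \<rho>: "\<rho> iz = 0"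
  shows "fst (run n check_matching \<rho> s) (Ok, 0, 0) =
    (if \<forall>i < n. \<exists>j < n. fst s (Match, i, j) = 1 then fst s (Ok, 0, 0) else 0)"
proof -
  let ?I = "\<lambda>i (s' :: store \<times> bool list). fst s' (Ok, 0, 0) =
      (if \<forall>i' < i. \<exists>j < n. fst s (Match, i', j) = 1 then fst s (Ok, 0, 0) else 0) \<and>
    (\<forall>uv. fst s' (Match, uv) = fst s (Match, uv))"
  have "?I n (run n check_matching \<rho> s)"
    unfolding check_matching_def
  proof (rule run_For_invariant[where I = ?I])
    fix i s' assume "i < n" "?I i s'"
    then show "?I (Suc i) (run n (scan ; If Flag iz iz 0 (Write Ok iz iz 0) Nop) (\<rho>(ii := i)) s')"
      using run_scan[of "\<rho>(ii := i)" n s'] \<rho> by (auto simp: less_Suc_eq)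
  qed simp
  then show ?thesis by simp
qed

definition copy :: cmd where
  "copy = For ii (For ij (If Adj ii ij 2 (Write New ii ij 2) Nop))"

lemma run_copy:
  "run n copy \<rho> s = ((\<lambda>(a, u, v). if a = New \<and> u < n \<and> v < n \<and> fst s (Adj, u, v) = 2 then 2
     else fst s (a, u, v)), snd s)"
proof -
  let ?I = "\<lambda>i s'. s' = ((\<lambda>(a, u, v). if a = New \<and> u < i \<and> v < n \<and> fst s (Adj, u, v) = 2 then 2
     else fst s (a, u, v)), snd s)"
  show ?thesis
    unfolding copy_def
  proof (rule run_For_invariant[where I = ?I])
    fix i s' assume i: "i < n" and I: "?I i s'"
    let ?J = "\<lambda>j s''. s'' = ((\<lambda>(a, u, v). if a = New \<and> u = i \<and> v < j \<and> fst s (Adj, u, v) = 2 then 2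
     else fst s' (a, u, v)), snd s')"
    have "?J n (run n (For ij (If Adj ii ij 2 (Write New ii ij 2) Nop)) (\<rho>(ii := i)) s')"
      by (rule run_For_invariant[where I = ?J])
        (use I in \<open>auto simp: less_Suc_eq fun_eq_iff\<close>)
    then show "?I (Suc i) (run n (For ij (If Adj ii ij 2 (Write New ii ij 2) Nop)) (\<rho>(ii := i)) s')"
      using I by (auto simp: less_Suc_eq fun_eq_iff simp del: run.simps)
  qed auto
qed

text \<open>The loop looks for the current vertex, joins it to the new one in both directions and
  demotes it. The new vertex becomes current only after the loop, lest it be joined to itself; at
  the start of the tour there is no current vertex and nothing is joined.\<close>

definition visit :: cmd where
  "visit =
     Write Flag iz iz 1 ;
     For iw (If Vis iw iz 1 (Write New iw ik 2 ; Write New ik iw 2 ; Write Vis iw iz 2) Nop) ;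
     Write Vis ik iz 1 ; Write Ord ii ik 1"

text \<open>One step along the permutation, taken only if it leads to an unvisited vertex. If it
  does not apply, the flag is still 0 and \<open>jump\<close> takes the first unvisited vertex
  instead.\<close>

definition follow :: cmd where
  "follow = For ij (For ik (If Flag iz iz 0 (If Vis ij iz 1 (If Match ij ik 1 (If Vis ik iz 0 visit Nop)
     Nop) Nop) Nop))"

definition jump :: cmd where
  "jump = For ik (If Flag iz iz 0 (If Vis ik iz 0 visit Nop) Nop)"

definition advance :: cmd where
  "advance = Write Flag iz iz 0 ; follow ; jump"

text \<open>After the last step the current vertex is the end of the tour, and row 0 of
  \<open>Ord\<close> names its beginning.\<close>

definition close :: cmd where
  "close = For ij (For ik (If Vis ij iz 1 (If Ord iz ik 1 (Write New ij ik 2 ; Write New ik ij 2) Nop) Nop))"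

definition tour :: cmd where
  "tour = For ii advance ; close"

definition visited :: "nat \<Rightarrow> nat \<Rightarrow> nat \<Rightarrow> store \<Rightarrow> store" where
  "visited n i k st = (\<lambda>(a, u, v).
     if a = Flag \<and> u = 0 \<and> v = 0 then 1
     else if a = Ord \<and> u = i \<and> v = k then 1
     else if a = Vis \<and> u = k \<and> v = 0 then 1
     else if a = Vis \<and> u < n \<and> v = 0 \<and> st (Vis, u, 0) = 1 then 2
     else if a = New \<and> v = k \<and> u < n \<and> st (Vis, u, 0) = 1 then 2
     else if a = New \<and> u = k \<and> v < n \<and> st (Vis, v, 0) = 1 then 2
     else st (a, u, v))"

lemma run_visit:
  assumes \<rho>: "\<rho> iz = 0"
  shows "run n visit \<rho> s = (visited n (\<rho> ii) (\<rho> ik) (fst s), snd s)"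
proof -
  let ?k = "\<rho> ik"
  let ?st = "(fst s)((Flag, 0, 0) := 1)"
  let ?I = "\<lambda>w s'. s' = ((\<lambda>(a, u, v).
     if a = Vis \<and> u < w \<and> v = 0 \<and> fst s (Vis, u, 0) = 1 then 2
     else if a = New \<and> v = ?k \<and> u < w \<and> fst s (Vis, u, 0) = 1 then 2
     else if a = New \<and> u = ?k \<and> v < w \<and> fst s (Vis, v, 0) = 1 then 2
     else ?st (a, u, v)), snd s)"
  let ?c = "If Vis iw iz 1 (Write New iw ik 2 ; Write New ik iw 2 ; Write Vis iw iz 2) Nop"
  have "?I n (run n (For iw ?c) \<rho> (?st, snd s))"
  proof (rule run_For_invariant[where I = ?I])
    fix w s' assume w: "w < n" and I: "?I w s'"
    have "fst s' (Vis, w, 0) = fst s (Vis, w, 0)" using I by simp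
    then have run: "run n ?c (\<rho>(iw := w)) s' = (if fst s (Vis, w, 0) = 1
        then ((fst s')((New, w, ?k) := 2, (New, ?k, w) := 2, (Vis, w, 0) := 2), snd s') else s')"
      using \<rho> by simp
    have "fst (run n ?c (\<rho>(iw := w)) s') (a, u, v) = (
       if a = Vis \<and> u < Suc w \<and> v = 0 \<and> fst s (Vis, u, 0) = 1 then 2
       else if a = New \<and> v = ?k \<and> u < Suc w \<and> fst s (Vis, u, 0) = 1 then 2
       else if a = New \<and> u = ?k \<and> v < Suc w \<and> fst s (Vis, v, 0) = 1 then 2
       else ?st (a, u, v))" for a u v
    proof -
      consider "a = Vis" | "a = New" | "a \<noteq> Vis" "a \<noteq> New" by blast
      then show ?thesis
        unfolding run by cases (use I in \<open>auto simp: less_Suc_eq\<close>)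
    qed
    moreover have "snd (run n ?c (\<rho>(iw := w)) s') = snd s" using run I by simp
    moreover obtain st out where "run n ?c (\<rho>(iw := w)) s' = (st, out)" by (rule prod.exhaust)
    ultimately show "?I (Suc w) (run n ?c (\<rho>(iw := w)) s')"
      by (simp only: fst_conv snd_conv) (simp add: fun_eq_iff)
  qed (auto simp: fun_eq_iff)
  then show ?thesis
    using \<rho> unfolding visit_def by (auto simp: visited_def fun_eq_iff simp del: run.simps(5))
qed

section \<open>Invariant of the tour\<close>

definition joins :: "nat list \<Rightarrow> nat \<Rightarrow> nat \<Rightarrow> bool" where
  "joins c u v \<longleftrightarrow> (\<exists>l. Suc l < length c \<and> (c ! l = u \<and> c ! Suc l = v \<or> c ! l = v \<and> c ! Suc l = u))"

definition tour_state :: "nat \<Rightarrow> (nat \<Rightarrow> nat \<Rightarrow> bool) \<Rightarrow> store \<Rightarrow> nat list \<Rightarrow> bool" where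
  "tour_state n E st c \<longleftrightarrow> distinct c \<and> set c \<subseteq> {..<n} \<and>
     (\<forall>v < n. st (Vis, v, 0) = (if v \<in> set c then if v = last c then 1 else 2 else 0)) \<and>
     (\<forall>t < n. \<forall>v < n. st (Ord, t, v) = (if t < length c \<and> c ! t = v then 1 else 0)) \<and>
     (\<forall>u < n. \<forall>v < n. st (New, u, v) = 2 \<longleftrightarrow> E u v \<or> joins c u v)"

lemma joins_snoc: "joins (c @ [v]) u w \<longleftrightarrow> joins c u w \<or> c \<noteq> [] \<and> (u = last c \<and> w = v \<or> u = v \<and> w = last c)"
proof -
  have "l < length c \<longleftrightarrow> Suc l < length c \<or> c \<noteq> [] \<and> l = length c - 1" for l
    by (cases c) auto
  then have "(\<exists>l. l < length c \<and> P l) \<longleftrightarrow> (\<exists>l. Suc l < length c \<and> P l) \<or> c \<noteq> [] \<and> P (length c - 1)" for P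
    by blast
  note split = this
  have "joins (c @ [v]) u w \<longleftrightarrow>
      (\<exists>l. l < length c \<and> ((c @ [v]) ! l = u \<and> (c @ [v]) ! Suc l = w \<or> (c @ [v]) ! l = w \<and> (c @ [v]) ! Suc l = u))"
    by (simp add: joins_def)
  also have "\<dots> \<longleftrightarrow> joins c u w \<or> c \<noteq> [] \<and> (u = last c \<and> w = v \<or> u = v \<and> w = last c)"
    unfolding split by (auto simp: joins_def nth_append last_conv_nth)
  finally show ?thesis .
qed

lemma tour_state_last: "tour_state n E st c \<Longrightarrow> c \<noteq> [] \<Longrightarrow> last c < n"
  using last_in_set[of c] unfolding tour_state_def by blast

lemma tour_state_visited:
  assumes "tour_state n E st c" "v < n" "v \<notin> set c" "length c < n"
  shows "tour_state n E (visited n (length c) v st) (c @ [v])"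
proof -
  have vis: "st (Vis, u, 0) = 1 \<longleftrightarrow> c \<noteq> [] \<and> u = last c" if "u < n" for u
    using assms(1) that by (cases "c = []") (auto simp: tour_state_def)
  have "last c < n" if "c \<noteq> []" using assms(1) that by (rule tour_state_last)
  moreover have "visited n (length c) v st (New, u, w) = 2 \<longleftrightarrow> E u w \<or> joins (c @ [v]) u w"
    if "u < n" "w < n" for u w
    using assms(1) that vis unfolding joins_snoc by (auto simp: visited_def tour_state_def)
  moreover have "visited n (length c) v st (Vis, u, 0) =
      (if u \<in> set (c @ [v]) then if u = last (c @ [v]) then 1 else 2 else 0)" if "u < n" for u
    using assms(1,3) that vis[OF that] by (auto simp: visited_def tour_state_def)
  moreover have "visited n (length c) v st (Ord, t, u) =
      (if t < length (c @ [v]) \<and> (c @ [v]) ! t = u then 1 else 0)" if "t < n" "u < n" for t u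
    using assms(1) that by (auto simp: visited_def tour_state_def nth_append less_Suc_eq)
  ultimately show ?thesis
    using assms unfolding tour_state_def by auto
qed

lemma run_advance:
  assumes \<rho>: "\<rho> iz = 0" "\<rho> ii = length c"
    and st: "tour_state n E (fst s) c" "length c < n"
    and \<pi>: "\<forall>j < n. \<pi> j < n" "\<forall>j < n. \<forall>k < n. fst s (Match, j, k) = 1 \<longleftrightarrow> \<pi> j = k"
  shows "\<exists>v. (c = [] \<or> v = \<pi> (last c) \<or> \<pi> (last c) \<in> set c) \<and>
    tour_state n E (fst (run n advance \<rho> s)) (c @ [v])"
proof -
  let ?s = "((fst s)((Flag, 0, 0) := 0), snd s)"
  \<comment> \<open>Besides the extended tour, \<open>D\<close> contains the set flag, so that the
    remaining rounds and \<open>jump\<close> leave the state alone.\<close>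
  define D where "D s' \<longleftrightarrow> (\<exists>v. (c = [] \<or> v = \<pi> (last c) \<or> \<pi> (last c) \<in> set c) \<and>
    tour_state n E (fst s') (c @ [v])) \<and> fst s' (Flag, 0, 0) = 1" for s' :: "store \<times> bool list"
  have s: "tour_state n E (fst ?s) c" using st(1) by (simp add: tour_state_def)
  have vis: "fst ?s (Vis, v, 0) = 1 \<longleftrightarrow> c \<noteq> [] \<and> v = last c"
    "fst ?s (Vis, v, 0) = 0 \<longleftrightarrow> v \<notin> set c" if "v < n" for v
    using s that by (cases "c = []"; auto simp: tour_state_def)+
  have mat: "fst ?s (Match, j, k) = 1 \<longleftrightarrow> \<pi> j = k" if "j < n" "k < n" for j k
    using \<pi>(2) that by simp
  have visit: "D (run n visit \<rho>' ?s)"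
    if "\<rho>' iz = 0" "\<rho>' ii = length c" "\<rho>' ik = v" "v < n" "v \<notin> set c"
      "c = [] \<or> v = \<pi> (last c) \<or> \<pi> (last c) \<in> set c" for \<rho>' v
  proof -
    have "fst (run n visit \<rho>' ?s) = visited n (length c) v (fst ?s)"
      using run_visit[of \<rho>' n ?s] that by simp
    then show ?thesis
      using tour_state_visited[OF s that(4,5) st(2)] that(6) unfolding D_def
      by (auto simp: visited_def)
  qed
  let ?follow = "If Flag iz iz 0 (If Vis ij iz 1 (If Match ij ik 1 (If Vis ik iz 0 visit Nop) Nop) Nop) Nop"
  have stop: "run n ?follow \<rho>' s' = s'" "run n (If Flag iz iz 0 (If Vis ik iz 0 visit Nop) Nop) \<rho>' s' = s'"
    if "D s'" "\<rho>' iz = 0" for s' \<rho>'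
    using that by (auto simp: D_def)
  let ?Q = "\<lambda>j k. c \<noteq> [] \<and> j = last c \<and> \<pi> j = k \<and> k \<notin> set c"
  have "run n follow \<rho> ?s = ?s \<and> (\<forall>j < n. \<not> (\<exists>k < n. ?Q j k)) \<or> D (run n follow \<rho> ?s)"
    unfolding follow_def
  proof (rule run_For_search)
    fix j assume j: "j < n"
    have "run n (For ik ?follow) (\<rho>(ij := j)) ?s = ?s \<and> (\<forall>k < n. \<not> ?Q j k) \<or>
      D (run n (For ik ?follow) (\<rho>(ij := j)) ?s)"
    proof (rule run_For_search)
      fix k assume k: "k < n"
      let ?\<rho> = "\<rho>(ij := j, ik := k)"
      show "run n ?follow ?\<rho> ?s = ?s \<and> \<not> ?Q j k \<or> D (run n ?follow ?\<rho> ?s)"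
      proof (cases "?Q j k")
        case True
        then have "run n ?follow ?\<rho> ?s = run n visit ?\<rho> ?s"
          using \<rho> vis(1)[OF j] vis(2)[OF k] mat[OF j k] by auto
        moreover have "D (run n visit ?\<rho> ?s)"
          using True \<rho> k by (intro visit[of _ k]) auto
        ultimately show ?thesis by simp
      next
        case False
        then show ?thesis
          using \<rho> vis(1)[OF j] vis(2)[OF k] mat[OF j k] by auto
      qed
    qed (use stop \<rho> in auto)
    then show "run n (For ik ?follow) (\<rho>(ij := j)) ?s = ?s \<and> \<not> (\<exists>k < n. ?Q j k) \<or>
      D (run n (For ik ?follow) (\<rho>(ij := j)) ?s)" by blast
  next
    fix j s' assume "D s'"
    then show "run n (For ik ?follow) (\<rho>(ij := j)) s' = s'"
      by (intro run_For_unchanged stop) (use \<rho> in auto)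
  qed
  then have "D (run n jump \<rho> (run n follow \<rho> ?s))"
  proof (elim disjE conjE)
    assume eq: "run n follow \<rho> ?s = ?s" and none: "\<forall>j < n. \<not> (\<exists>k < n. ?Q j k)"
    have c: "c = [] \<or> \<pi> (last c) \<in> set c"
    proof (rule disjCI)
      assume "\<pi> (last c) \<notin> set c"
      show "c = []"
      proof (rule ccontr)
        assume "c \<noteq> []"
        then have "last c < n" using tour_state_last[OF s] by simp
        then show False using none \<pi>(1) \<open>c \<noteq> []\<close> \<open>\<pi> (last c) \<notin> set c\<close> by blast
      qed
    qed
    have "run n jump \<rho> ?s = ?s \<and> (\<forall>k < n. \<not> k \<notin> set c) \<or> D (run n jump \<rho> ?s)"
      unfolding jump_def
    proof (rule run_For_search)
      fix k assume k: "k < n"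
      let ?\<rho> = "\<rho>(ik := k)" and ?c = "If Flag iz iz 0 (If Vis ik iz 0 visit Nop) Nop"
      show "run n ?c ?\<rho> ?s = ?s \<and> \<not> k \<notin> set c \<or> D (run n ?c ?\<rho> ?s)"
      proof (cases "k \<in> set c")
        case True
        then show ?thesis using \<rho> vis(2)[OF k] by simp
      next
        case False
        then have "run n ?c ?\<rho> ?s = run n visit ?\<rho> ?s" using \<rho> vis(2)[OF k] by simp
        moreover have "D (run n visit ?\<rho> ?s)"
          using False c \<rho> k by (intro visit[of _ k]) auto
        ultimately show ?thesis by simp
      qed
    qed (use stop \<rho> in auto)
    \<comment> \<open>The tour has fewer than n vertices, so \<open>jump\<close> cannot end without
      success.\<close>
    moreover have "\<exists>k < n. k \<notin> set c"
    proof (rule ccontr)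
      assume "\<not> (\<exists>k < n. k \<notin> set c)"
      then have "{..<n} \<subseteq> set c" by auto
      then have "n \<le> card (set c)" using card_mono[of "set c" "{..<n}"] by simp
      then show False using card_length[of c] st(2) by simp
    qed
    ultimately show ?thesis using eq by auto
  next
    assume "D (run n follow \<rho> ?s)"
    moreover from this have "run n jump \<rho> (run n follow \<rho> ?s) = run n follow \<rho> ?s"
      unfolding jump_def by (intro run_For_unchanged stop) (use \<rho> in auto)
    ultimately show ?thesis by simp
  qed
  then show ?thesis using \<rho> unfolding D_def advance_def by simp
qed

text \<open>All that is remembered about the choice of steps: the tour departs from \<pi> only where
  the next vertex along \<pi> has been visited. This suffices for the new edges to form a matching,
  whatever vertex a jump selects.\<close>

definition greedy :: "(nat \<Rightarrow> nat) \<Rightarrow> nat list \<Rightarrow> bool" where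
  "greedy \<pi> c \<longleftrightarrow> (\<forall>l. Suc l < length c \<longrightarrow> c ! Suc l = \<pi> (c ! l) \<or> \<pi> (c ! l) \<in> set (take (Suc l) c))"

lemma greedy_snoc:
  assumes "greedy \<pi> c" "c = [] \<or> v = \<pi> (last c) \<or> \<pi> (last c) \<in> set c"
  shows "greedy \<pi> (c @ [v])"
  unfolding greedy_def
proof (intro allI impI)
  fix l assume l: "Suc l < length (c @ [v])"
  show "(c @ [v]) ! Suc l = \<pi> ((c @ [v]) ! l) \<or> \<pi> ((c @ [v]) ! l) \<in> set (take (Suc l) (c @ [v]))"
  proof (cases "Suc l < length c")
    case True
    then show ?thesis using assms(1) by (auto simp: greedy_def nth_append)
  next
    case False
    then have "Suc l = length c" using l by simp
    moreover from this have "c \<noteq> []" by auto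
    moreover from calculation have "last c = c ! l" by (metis last_conv_nth diff_Suc_1)
    ultimately show ?thesis using assms(2) by (auto simp: nth_append)
  qed
qed

definition linked :: "nat list \<Rightarrow> nat \<Rightarrow> nat \<Rightarrow> bool" where
  "linked c u v \<longleftrightarrow> joins c u v \<or> u = last c \<and> v = hd c \<or> u = hd c \<and> v = last c"

lemma run_tour:
  assumes \<rho>: "\<rho> iz = 0" and n: "0 < n"
    and st: "tour_state n E (fst s) []"
    and \<pi>: "\<forall>j < n. \<pi> j < n" "\<forall>j < n. \<forall>k < n. fst s (Match, j, k) = 1 \<longleftrightarrow> \<pi> j = k"
  shows "\<exists>c. distinct c \<and> set c = {..<n} \<and> greedy \<pi> c \<and>
    (\<forall>t < n. \<forall>v < n. fst (run n tour \<rho> s) (Ord, t, v) = (if c ! t = v then 1 else 0)) \<and>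
    (\<forall>u < n. \<forall>v < n. fst (run n tour \<rho> s) (New, u, v) = 2 \<longleftrightarrow> E u v \<or> linked c u v)"
proof -
  let ?I = "\<lambda>i (s' :: store \<times> bool list). \<exists>c. length c = i \<and> greedy \<pi> c \<and> tour_state n E (fst s') c \<and>
    (\<forall>uv. fst s' (Match, uv) = fst s (Match, uv))"
  let ?s = "run n (For ii advance) \<rho> s"
  have "?I n ?s"
  proof (rule run_For_invariant[where I = ?I])
    fix i s' assume i: "i < n" and "?I i s'"
    then obtain c where c: "length c = i" "greedy \<pi> c" "tour_state n E (fst s') c"
      "\<And>uv. fst s' (Match, uv) = fst s (Match, uv)" by blast
    let ?s' = "run n advance (\<rho>(ii := i)) s'"
    obtain v where "c = [] \<or> v = \<pi> (last c) \<or> \<pi> (last c) \<in> set c" "tour_state n E (fst ?s') (c @ [v])"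
      using run_advance[of "\<rho>(ii := i)" c n E s' \<pi>] \<rho> c i \<pi> by auto
    moreover have "fst ?s' (Match, uv) = fst s' (Match, uv)" for uv
      by (rule run_frame) (simp add: advance_def follow_def jump_def visit_def)
    ultimately show "?I (Suc i) ?s'"
      using c greedy_snoc[of \<pi> c v] by (intro exI[of _ "c @ [v]"]) auto
  qed (use st in \<open>auto simp: greedy_def\<close>)
  then obtain c where c: "length c = n" "greedy \<pi> c" "tour_state n E (fst ?s) c" by blast
  have dist: "distinct c" "set c \<subseteq> {..<n}" using c(3) by (auto simp: tour_state_def)
  then have set: "set c = {..<n}"
    using c(1) distinct_card[OF dist(1)] by (intro card_subset_eq) auto
  have ne: "c \<noteq> []" using c(1) n by auto
  then have last: "last c < n" and hd: "hd c < n" using set last_in_set hd_in_set by blast+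
  let ?s1 = "((fst ?s)((New, last c, hd c) := 2, (New, hd c, last c) := 2), snd ?s)"
  have "run n tour \<rho> s = run n close \<rho> ?s" by (simp add: tour_def)
  also have "\<dots> = (if \<exists>j < n. \<exists>k < n. j = last c \<and> k = hd c then ?s1 else ?s)"
    unfolding close_def
  proof (rule run_For_mark[where ?s0.0 = ?s], rule run_For_mark[where ?s0.0 = ?s])
    fix j k s' assume j: "j < n" and k: "k < n" and s': "s' = ?s \<or> s' = ?s1"
    \<comment> \<open>Closing writes to \<open>New\<close> only, so the tests have the same outcome
      before and after it, as required of a loop that marks.\<close>
    have "fst s' (Vis, j, 0) = fst ?s (Vis, j, 0)" "fst s' (Ord, 0, k) = fst ?s (Ord, 0, k)"
      using s' by auto
    then have "fst s' (Vis, j, 0) = 1 \<longleftrightarrow> j = last c" "fst s' (Ord, 0, k) = 1 \<longleftrightarrow> k = hd c"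
      using c(1,3) j k n set ne by (auto simp: tour_state_def hd_conv_nth)
    moreover have "((fst s')((New, last c, hd c) := 2, (New, hd c, last c) := 2), snd s') = ?s1"
      using s' by (auto simp: fun_eq_iff)
    ultimately show "run n (If Vis ij iz 1 (If Ord iz ik 1 (Write New ij ik 2 ; Write New ik ij 2) Nop) Nop)
        (\<rho>(ij := j, ik := k)) s' = (if j = last c \<and> k = hd c then ?s1 else s')"
      using \<rho> by (auto simp del: run.simps(5))
  qed auto
  also have "\<dots> = ?s1" using last hd by auto
  finally have run: "run n tour \<rho> s = ?s1" .
  show ?thesis
    using c dist set unfolding run
    by (intro exI[of _ c]) (auto simp: tour_state_def linked_def)
qed

section \<open>The whole program\<close>

text \<open>Every bit is written twice, because \<open>enc_pair\<close> doubles its first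
  component.\<close>

definition out_graph :: cmd where
  "out_graph =
     For ii (Out True ; Out True) ; Out False ; Out False ;
     For ii (For ij (If New ii ij 2 (Out True ; Out True) (Out False ; Out False)))"

text \<open>Vertex k is written in unary by one \<open>True\<close> for each index below k; this is
  where the order matrix replaces arithmetic.\<close>

definition out_cycle :: cmd where
  "out_cycle =
     For ii (For ik (If Ord ii ik 1 (For iw (If Below iw ik 1 (Out True) Nop) ; Out False) Nop))"

abbreviation double :: "bool list \<Rightarrow> bool list" where
  "double xs \<equiv> concat (map (\<lambda>x. [x, x]) xs)"

lemma double_concat: "double (concat xss) = concat (map double xss)"
  by (induction xss) auto

lemma enc_matrix_cong:
  "(\<And>u v. u < n \<Longrightarrow> v < n \<Longrightarrow> E u v = E' u v) \<Longrightarrow> enc_matrix n E = enc_matrix n E'"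
  unfolding enc_matrix_def by (intro arg_cong[where f = concat] map_cong) auto

lemma run_out_graph:
  "run n out_graph \<rho> (st, out) =
    (st, out @ double (enc_unary n @ enc_matrix n (\<lambda>u v. st (New, u, v) = 2)))"
proof -
  let ?E = "\<lambda>u v. st (New, u, v) = 2"
  let ?c = "If New ii ij 2 (Out True ; Out True) (Out False ; Out False)"
  have 1: "run n (For ii (Out True ; Out True)) \<rho> (st, out) =
      (st, out @ concat (map (\<lambda>_. [True, True]) [0..<n]))" for out
    by (rule run_For_output) simp
  have 2: "concat (map (\<lambda>_. [True, True]) [0..<n]) = double (replicate n True)"
    by (simp add: map_replicate_const)
  have "run n (For ij ?c) (\<rho>(ii := i)) (st, out) = (st, out @ concat (map (\<lambda>j. [?E i j, ?E i j]) [0..<n]))"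
    for i out
    by (rule run_For_output) auto
  then have "run n (For ii (For ij ?c)) \<rho> (st, out) =
      (st, out @ concat (map (\<lambda>i. concat (map (\<lambda>j. [?E i j, ?E i j]) [0..<n])) [0..<n]))" for out
    by (rule run_For_output)
  moreover have "concat (map (\<lambda>i. concat (map (\<lambda>j. [?E i j, ?E i j]) [0..<n])) [0..<n])
      = double (enc_matrix n ?E)"
    unfolding enc_matrix_def double_concat by (simp add: o_def)
  ultimately show ?thesis
    unfolding out_graph_def run.simps(2) 1 2 by (simp add: enc_unary_def del: run.simps(5))
qed

lemma concat_map_select:
  "a < n \<Longrightarrow> concat (map (\<lambda>k. if a = k then f k else []) [0..<n]) = f a"
  by (induction n) (auto simp: less_Suc_eq)

lemma concat_map_below:
  "k \<le> n \<Longrightarrow> concat (map (\<lambda>w. if w < k then [x] else []) [0..<n]) = replicate k x"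
proof -
  let ?f = "\<lambda>w. if w < k then [x] else []"
  assume "k \<le> n"
  then have "[0..<n] = [0..<k] @ [k..<n]" using upt_add_eq_append[of 0 k "n - k"] by simp
  moreover have "concat (map ?f [0..<j]) = replicate j x" if "j \<le> k" for j
    using that by (induction j) (auto simp: replicate_append_same)
  ultimately show ?thesis by simp
qed

lemma run_out_cycle:
  assumes c: "length c = n" "set c \<subseteq> {..<n}"
    and ord: "\<forall>t < n. \<forall>v < n. st (Ord, t, v) = (if c ! t = v then 1 else 0)"
    and below: "\<forall>u < n. \<forall>v < n. st (Below, u, v) = (if u < v then 1 else 0)"
  shows "run n out_cycle \<rho> (st, out) = (st, out @ enc_cycle c)"
proof -
  let ?d = "For iw (If Below iw ik 1 (Out True) Nop)"
  let ?c = "If Ord ii ik 1 (?d ; Out False) Nop"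
  have 1: "run n ?d (\<rho>(ii := i, ik := k)) (st, out) = (st, out @ replicate k True)"
    if "k < n" for i k out
  proof -
    have "run n ?d (\<rho>(ii := i, ik := k)) (st, out) =
        (st, out @ concat (map (\<lambda>w. if w < k then [True] else []) [0..<n]))"
      by (rule run_For_output) (use below that in auto)
    then show ?thesis using that by (simp add: concat_map_below del: run.simps(5))
  qed
  have "run n (For ik ?c) (\<rho>(ii := i)) (st, out) = (st, out @ enc_unary (c ! i))" if "i < n" for i out
  proof -
    have "run n (For ik ?c) (\<rho>(ii := i)) (st, out) =
        (st, out @ concat (map (\<lambda>k. if c ! i = k then enc_unary k else []) [0..<n]))"
      by (rule run_For_output) (use ord that 1 in \<open>simp add: enc_unary_def del: run.simps(5)\<close>)
    moreover have "c ! i < n" using c that nth_mem[of i c] by blast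
    ultimately show ?thesis by (simp add: concat_map_select del: run.simps(5))
  qed
  then have "run n out_cycle \<rho> (st, out) = (st, out @ concat (map (\<lambda>i. enc_unary (c ! i)) [0..<n]))"
    unfolding out_cycle_def by (rule run_For_output)
  moreover have "map (\<lambda>i. enc_unary (c ! i)) [0..<n] = map enc_unary c"
    using c(1) by (intro nth_equalityI) auto
  ultimately show ?thesis by (simp add: enc_cycle_def)
qed

text \<open>The first \<open>True\<close> says that a pair exists, \<open>False\<close> and
  \<open>True\<close> separate its components, and the last test chooses between a cycle and nil. If
  \<open>Ok\<close> is not set, \<open>New\<close> is still a copy of the input graph.\<close>

definition program :: cmd where
  "program =
     compare ; check_size ; auction ; check_matching ; copy ; If Ok iz iz 1 tour Nop ;
     Out True ; out_graph ; Out False ; Out True ; If Ok iz iz 1 (Out True ; out_cycle) (Out False)"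

lemma wf_program: "wf_cmd program"
  by (simp add: program_def compare_def check_size_def auction_def bid_def scan_def search_def
      purchase_def check_matching_def copy_def tour_def advance_def follow_def jump_def visit_def
      close_def out_graph_def out_cycle_def arrays_def indices_def)

lemma written_simps:
  "written compare = {Below, Mark}" "written check_size = {Ok}"
  "written auction = {Flag, Price, Match}" "written check_matching = {Flag, Ok}"
  "written copy = {New}" "written tour = {Flag, New, Vis, Ord}"
  by (auto simp: compare_def check_size_def auction_def bid_def scan_def search_def
      purchase_def check_matching_def copy_def tour_def advance_def follow_def jump_def visit_def close_def)

lemma silent_simps:
  "silent compare" "silent check_size" "silent auction" "silent check_matching" "silent copy" "silent tour"
  by (auto simp: compare_def check_size_def auction_def bid_def scan_def search_def
      purchase_def check_matching_def copy_def tour_def advance_def follow_def jump_def visit_def close_def)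

definition permutes_along :: "nat \<Rightarrow> (nat \<Rightarrow> nat \<Rightarrow> bool) \<Rightarrow> (nat \<Rightarrow> nat) \<Rightarrow> bool" where
  "permutes_along n E \<pi> \<longleftrightarrow> inj_on \<pi> {..<n} \<and> (\<forall>i < n. \<pi> i < n \<and> E i (\<pi> i))"

lemma run_program:
  fixes E :: "nat \<Rightarrow> nat \<Rightarrow> bool"
  assumes n: "0 < n"
  defines "y \<equiv> snd (run n program (\<lambda>_. 0) (initial_store n E, []))"
  shows "(\<exists>\<pi> c. 3 \<le> n \<and> permutes_along n E \<pi> \<and> distinct c \<and> set c = {..<n} \<and> greedy \<pi> c \<and>
      y = True # double (enc_unary n @ enc_matrix n (\<lambda>u v. E u v \<or> linked c u v)) @
        [False, True] @ True # enc_cycle c) \<or>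
    ((n < 3 \<or> (\<nexists>\<pi>. permutes_along n E \<pi>)) \<and>
      y = True # double (enc_unary n @ enc_matrix n E) @ [False, True] @ [False])"
proof -
  let ?\<rho> = "\<lambda>_. 0 :: nat"
  define s0 where "s0 = (initial_store n E, [] :: bool list)"
  define s1 where "s1 = run n compare ?\<rho> s0"
  define s2 where "s2 = run n check_size ?\<rho> s1"
  define s3 where "s3 = run n auction ?\<rho> s2"
  define s4 where "s4 = run n check_matching ?\<rho> s3"
  define s5 where "s5 = run n copy ?\<rho> s4"
  define s6 where "s6 = run n (If Ok iz iz 1 tour Nop) ?\<rho> s5"
  have out: "snd s6 = []"
    unfolding s6_def s5_def s4_def s3_def s2_def s1_def
    by (simp add: run_silent silent_simps s0_def)
  have init: "fst s0 (a, uv) = 0" if "a \<noteq> Adj" for a uv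
    using that by (cases uv) (simp add: s0_def initial_store_def)
  have frame1: "fst s1 (a, uv) = fst s0 (a, uv)" if "a \<noteq> Below" "a \<noteq> Mark" for a uv
    unfolding s1_def by (rule run_frame) (use that in \<open>simp add: written_simps\<close>)
  have frame2: "fst s2 (a, uv) = fst s1 (a, uv)" if "a \<noteq> Ok" for a uv
    unfolding s2_def by (rule run_frame) (use that in \<open>simp add: written_simps\<close>)
  have frame3: "fst s3 (a, uv) = fst s2 (a, uv)" if "a \<noteq> Flag" "a \<noteq> Price" "a \<noteq> Match" for a uv
    unfolding s3_def by (rule run_frame) (use that in \<open>simp add: written_simps\<close>)
  have frame4: "fst s4 (a, uv) = fst s3 (a, uv)" if "a \<noteq> Flag" "a \<noteq> Ok" for a uv
    unfolding s4_def by (rule run_frame) (use that in \<open>simp add: written_simps\<close>)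
  have frame5: "fst s5 (a, uv) = fst s4 (a, uv)" if "a \<noteq> New" for a uv
    unfolding s5_def by (rule run_frame) (use that in \<open>simp add: written_simps\<close>)
  have frame6: "fst s6 (a, uv) = fst s5 (a, uv)" if "a \<noteq> Flag" "a \<noteq> New" "a \<noteq> Vis" "a \<noteq> Ord" for a uv
    unfolding s6_def by (rule run_frame) (use that in \<open>simp add: written_simps\<close>)
  have edges0: "fst s0 (Adj, u, v) = bit_symbol (E u v)" if "u < n" "v < n" for u v
    using that by (simp add: s0_def initial_store_def)
  have below1: "\<forall>u < n. \<forall>v < n. fst s1 (Below, u, v) = (if u < v then 1 else 0)"
    unfolding s1_def by (rule run_compare) (use init in auto)
  have below6: "\<forall>u < n. \<forall>v < n. fst s6 (Below, u, v) = (if u < v then 1 else 0)"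
    using below1 by (simp add: frame6 frame5 frame4 frame3 frame2)
  have ok2: "fst s2 (Ok, 0, 0) = (if 3 \<le> n then 1 else 0)"
    unfolding s2_def by (rule run_check_size) (use below1 init frame1 in auto)
  \<comment> \<open>Blank arrays represent the start of the auction, with all prices 0 and no
    owners.\<close>
  have "auction_ok n E (fst s2) (\<lambda>_. 0) (\<lambda>_. None)"
    using init edges0
    by (simp add: auction_ok_def auction_state_def auction_inv_def has_edges_def frame2 frame1)
  then obtain p own where auction: "auction_ok n E (fst s3) p own" and settled: "settled n E p own"
    using run_auction[of ?\<rho> n E s2] unfolding s3_def by blast
  have inv: "auction_inv n E p own" using auction by (simp add: auction_ok_def)
  have match: "fst s3 (Match, i, j) = 1 \<longleftrightarrow> own j = Some i" if "i < n" "j < n" for i j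
    using auction that by (simp add: auction_ok_def auction_state_def)
  have "fst s4 (Ok, 0, 0) = (if \<forall>i < n. \<exists>j < n. fst s3 (Match, i, j) = 1 then fst s3 (Ok, 0, 0) else 0)"
    unfolding s4_def by (rule run_check_matching) simp
  moreover have "(\<forall>i < n. \<exists>j < n. fst s3 (Match, i, j) = 1) \<longleftrightarrow> (\<forall>i < n. assigned n own i)"
    unfolding assigned_def using match by blast
  ultimately have ok5: "fst s5 (Ok, 0, 0) = (if 3 \<le> n \<and> (\<forall>i < n. assigned n own i) then 1 else 0)"
    using ok2 by (simp add: frame5 frame3)
  have new5: "fst s5 (New, u, v) = 2 \<longleftrightarrow> E u v" if "u < n" "v < n" for u v
    using that init edges0 unfolding s5_def run_copy
    by (simp add: frame4 frame3 frame2 frame1 bit_symbol_def)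
  define st6 where "st6 = fst s6"
  have s6: "s6 = (st6, [])" using out by (simp add: st6_def prod_eq_iff)
  have "run n program ?\<rho> (initial_store n E, []) =
      run n (Out True ; out_graph ; Out False ; Out True ; If Ok iz iz 1 (Out True ; out_cycle) (Out False))
        ?\<rho> (st6, [])"
    unfolding s6[symmetric] s6_def s5_def s4_def s3_def s2_def s1_def s0_def program_def by (simp only: run.simps(2))
  then have y: "y = snd (run n (If Ok iz iz 1 (Out True ; out_cycle) (Out False)) ?\<rho>
      (st6, True # double (enc_unary n @ enc_matrix n (\<lambda>u v. st6 (New, u, v) = 2)) @ [False, True]))"
    unfolding y_def by (simp add: run_out_graph)
  show ?thesis
  proof (cases "3 \<le> n \<and> (\<forall>i < n. assigned n own i)")
    case True
    then have "\<forall>i. \<exists>j. i < n \<longrightarrow> j < n \<and> own j = Some i" by (auto simp: assigned_def)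
    then obtain \<pi> where \<pi>: "\<And>i. i < n \<Longrightarrow> \<pi> i < n" "\<And>i. i < n \<Longrightarrow> own (\<pi> i) = Some i" by metis
    have "inj_on \<pi> {..<n}"
      using \<pi>(2) by (metis (no_types, lifting) inj_onI lessThan_iff option.inject)
    then have perm: "permutes_along n E \<pi>"
      using inv \<pi> by (auto simp: permutes_along_def auction_inv_def)
    have match_\<pi>: "\<forall>i < n. \<forall>j < n. fst s5 (Match, i, j) = 1 \<longleftrightarrow> \<pi> i = j"
    proof (intro allI impI)
      fix i j assume ij: "i < n" "j < n"
      \<comment> \<open>Since ownership is injective, \<open>i\<close> has no second item, and
        \<open>Match\<close> is exactly the graph of \<pi>.\<close>
      have "own j = Some i \<longleftrightarrow> \<pi> i = j"
        using inv \<pi>[OF ij(1)] ij(2) unfolding auction_inv_def by (metis option.distinct(1))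
      then show "fst s5 (Match, i, j) = 1 \<longleftrightarrow> \<pi> i = j"
        using match[OF ij] by (simp add: frame5 frame4)
    qed
    have "tour_state n E (fst s5) []"
      using new5 init
      by (simp add: tour_state_def joins_def frame5 frame4 frame3 frame2 frame1)
    then obtain c where c: "distinct c" "set c = {..<n}" "greedy \<pi> c"
      "\<forall>t < n. \<forall>v < n. fst (run n tour ?\<rho> s5) (Ord, t, v) = (if c ! t = v then 1 else 0)"
      "\<forall>u < n. \<forall>v < n. fst (run n tour ?\<rho> s5) (New, u, v) = 2 \<longleftrightarrow> E u v \<or> linked c u v"
      using run_tour[of ?\<rho> n E s5 \<pi>] n \<pi>(1) match_\<pi> by blast
    have ok: "fst s5 (Ok, 0, 0) = 1" using ok5 True by simp
    then have "s6 = run n tour ?\<rho> s5" by (simp add: s6_def)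
    then have c': "\<forall>t < n. \<forall>v < n. st6 (Ord, t, v) = (if c ! t = v then 1 else 0)"
      "\<forall>u < n. \<forall>v < n. st6 (New, u, v) = 2 \<longleftrightarrow> E u v \<or> linked c u v"
      using c(4,5) by (simp_all add: st6_def)
    have len: "length c = n" using distinct_card[OF c(1)] c(2) by simp
    have "st6 (Ok, 0, 0) = 1" using ok frame6 by (simp add: st6_def)
    then have "y = True # double (enc_unary n @ enc_matrix n (\<lambda>u v. st6 (New, u, v) = 2)) @
        [False, True] @ True # enc_cycle c"
      unfolding y using run_out_cycle[OF len _ c'(1)] c(2) below6 by (simp add: st6_def)
    moreover have "enc_matrix n (\<lambda>u v. st6 (New, u, v) = 2) = enc_matrix n (\<lambda>u v. E u v \<or> linked c u v)"
      by (rule enc_matrix_cong) (use c'(2) in blast)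
    ultimately have "y = True # double (enc_unary n @ enc_matrix n (\<lambda>u v. E u v \<or> linked c u v)) @
        [False, True] @ True # enc_cycle c" by simp
    then show ?thesis using True perm c(1-3) by (intro disjI1 exI[of _ \<pi>] exI[of _ c]) blast
  next
    case False
    have "n < 3 \<or> (\<nexists>\<pi>. permutes_along n E \<pi>)"
    proof (rule disjCI)
      \<comment> \<open>If a permutation exists, no vertex can be unassigned and priced out, so the
        settled auction assigns every vertex; only the size test can then have failed.\<close>
      assume "\<not> (\<nexists>\<pi>. permutes_along n E \<pi>)"
      then obtain \<pi> where \<pi>: "permutes_along n E \<pi>" by blast
      have "assigned n own i" if "i < n" for i
      proof (rule ccontr)
        assume un: "\<not> assigned n own i"
        then have "priced_out n E p i" using settled that by (auto simp: settled_def)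
        then show False
          using no_matching_if_priced_out[OF inv that un, of \<pi>] \<pi> by (auto simp: permutes_along_def)
      qed
      then show "n < 3" using False by auto
    qed
    moreover have ok: "fst s5 (Ok, 0, 0) \<noteq> 1" using ok5 False by auto
    then have "s6 = s5" by (simp add: s6_def)
    then have "y = True # double (enc_unary n @ enc_matrix n (\<lambda>u v. st6 (New, u, v) = 2)) @
        [False, True] @ [False]"
      unfolding y using ok by (simp add: st6_def)
    moreover have "enc_matrix n (\<lambda>u v. st6 (New, u, v) = 2) = enc_matrix n E"
      by (rule enc_matrix_cong) (use new5 \<open>s6 = s5\<close> in \<open>simp add: st6_def\<close>)
    ultimately show ?thesis by simp
  qed
qed

section \<open>Correctness for graphs\<close>

definition successor_edges :: "nat list \<Rightarrow> nat set set" where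
  "successor_edges c = {{c ! l, c ! (Suc l mod length c)} | l. l < length c}"

text \<open>The program treats the closing edge apart, whereas \<open>hamiltonian_cycle\<close>
  includes it by taking positions modulo the length. The two descriptions agree because only the
  last position wraps around.\<close>

lemma linked_iff:
  assumes "c \<noteq> []"
  shows "linked c u v \<longleftrightarrow> {u, v} \<in> successor_edges c"
proof -
  obtain m where m: "length c = Suc m" using assms by (cases c) auto
  have "{u, v} \<in> successor_edges c \<longleftrightarrow> (\<exists>l < Suc m. {u, v} = {c ! l, c ! (Suc l mod Suc m)})"
    using m by (auto simp: successor_edges_def)
  also have "\<dots> \<longleftrightarrow> (\<exists>l < m. {u, v} = {c ! l, c ! Suc l}) \<or> {u, v} = {c ! m, c ! 0}"
    by (metis less_Suc_eq mod_less mod_self not_less_eq)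
  also have "(\<exists>l < m. {u, v} = {c ! l, c ! Suc l}) \<longleftrightarrow> joins c u v"
    using m by (auto simp: joins_def doubleton_eq_iff)
  also have "joins c u v \<or> {u, v} = {c ! m, c ! 0} \<longleftrightarrow> linked c u v"
    using m assms by (auto simp: linked_def doubleton_eq_iff last_conv_nth hd_conv_nth)
  finally show ?thesis by simp
qed

lemma Suc_mod_inj:
  assumes "i < n" "j < n" "Suc i mod n = Suc j mod n"
  shows "i = j"
proof -
  have "Suc k mod n = (if Suc k = n then 0 else Suc k)" if "k < n" for k
    using that by auto
  then show ?thesis using assms by (auto split: if_splits)
qed

text \<open>The permutation maps each vertex to its successor on the cycle: \<open>pos\<close>
  inverts the listing, and the cyclic shift of positions is injective.\<close>

lemma hamiltonian_permutes_along:
  assumes "hamiltonian_cycle G c" "verts G = {..<n}"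
  shows "3 \<le> n" "\<exists>\<pi>. permutes_along n (\<lambda>u v. {u, v} \<in> edges G) \<pi>"
proof -
  have c: "3 \<le> length c" "distinct c" "set c = {..<n}"
    "\<And>i. i < length c \<Longrightarrow> {c ! i, c ! (Suc i mod length c)} \<in> edges G"
    using assms by (auto simp: hamiltonian_cycle_def)
  have len: "length c = n" using distinct_card[OF c(2)] c(3) by simp
  then show "3 \<le> n" using c(1) by simp
  then have n: "0 < n" by simp
  have "\<forall>v. \<exists>i. v < n \<longrightarrow> i < n \<and> c ! i = v" using c(3) len by (metis in_set_conv_nth lessThan_iff)
  then obtain pos where pos: "\<And>v. v < n \<Longrightarrow> pos v < n \<and> c ! pos v = v" by metis
  define \<pi> where "\<pi> v = c ! (Suc (pos v) mod n)" for v
  have "inj_on \<pi> {..<n}"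
  proof (rule inj_onI)
    fix u v assume uv: "u \<in> {..<n}" "v \<in> {..<n}" "\<pi> u = \<pi> v"
    then have "Suc (pos u) mod n = Suc (pos v) mod n"
      using nth_eq_iff_index_eq[OF c(2)] len n by (simp add: \<pi>_def)
    moreover have "pos u < n" "pos v < n" using pos uv(1,2) by auto
    ultimately have "pos u = pos v" by (blast intro: Suc_mod_inj)
    then show "u = v" using pos[of u] pos[of v] uv by (metis lessThan_iff)
  qed
  moreover have "\<pi> v < n \<and> {v, \<pi> v} \<in> edges G" if "v < n" for v
  proof
    show "\<pi> v < n" using c(3) len n nth_mem[of "Suc (pos v) mod n" c] by (auto simp: \<pi>_def)
    show "{v, \<pi> v} \<in> edges G" using c(4)[of "pos v"] pos[OF that] len by (simp add: \<pi>_def)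
  qed
  ultimately show "\<exists>\<pi>. permutes_along n (\<lambda>u v. {u, v} \<in> edges G) \<pi>"
    by (auto simp: permutes_along_def)
qed

text \<open>
  When the tour leaves \<open>\<pi>\<close> after position m, the visited vertices form a union of cycles of \<open>\<pi>\<close>. The
  next vertex starts a new cycle; as \<open>\<pi>\<close> has no fixed points, it is followed along \<open>\<pi>\<close>.
\<close>

lemma greedy_follows:
  assumes greedy: "greedy \<pi> c" and c: "distinct c" "set c = {..<n}"
    and \<pi>: "inj_on \<pi> {..<n}" "\<And>i. i < n \<Longrightarrow> \<pi> i < n" "\<And>i. i < n \<Longrightarrow> \<pi> i \<noteq> i"
    and m: "m < n" "c ! (Suc m mod n) \<noteq> \<pi> (c ! m)"
  shows "c ! (Suc (Suc m mod n) mod n) = \<pi> (c ! (Suc m mod n))"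
proof -
  have len: "length c = n" using distinct_card[OF c(1)] c(2) by simp
  have nth: "c ! l < n" if "l < n" for l using c(2) len that nth_mem[of l c] by auto
  have n: "1 < n" using m(1) \<pi>(2,3)[of 0] by (cases "n = 1") auto
  show ?thesis
  proof (cases "Suc m = n")
    case True
    \<comment> \<open>Here the cyclic successor is the start of the tour. Nothing but the start
      itself was visited before the next step, and \<pi> has no fixed point, so that step follows
      \<pi>.\<close>
    have "c ! Suc 0 = \<pi> (c ! 0) \<or> \<pi> (c ! 0) \<in> set (take (Suc 0) c)"
      using greedy n len by (auto simp: greedy_def)
    moreover have "set (take (Suc 0) c) = {c ! 0}" using n len by (cases c) auto
    moreover have "\<pi> (c ! 0) \<noteq> c ! 0" using \<pi>(3) nth[of 0] n by simp
    ultimately show ?thesis using True n by auto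
  next
    case False
    then have l: "Suc m < n" using m(1) by simp
    let ?T = "set (take (Suc m) c)"
    have nth_T: "c ! k \<in> ?T" if "k \<le> m" for k
      using that l len by (auto simp: in_set_conv_nth intro!: exI[of _ k])
    have subset: "set (take (Suc k) c) \<subseteq> ?T" if "k \<le> m" for k
      using that by (intro set_take_subset_set_take) simp
    \<comment> \<open>For \<open>k < m\<close> the image of \<open>c ! k\<close> comes at position
      \<open>k + 1\<close> or earlier. At \<open>m\<close> the tour departs from \<pi>, which the
      greedy rule allows only if the image was visited already.\<close>
    have "\<pi> ` ?T \<subseteq> ?T"
    proof
      fix x assume "x \<in> \<pi> ` ?T"
      then obtain k where k: "k \<le> m" "x = \<pi> (c ! k)"
        using l len by (auto simp: in_set_conv_nth less_Suc_eq_le)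
      have step: "c ! Suc k = x \<or> x \<in> set (take (Suc k) c)"
        using greedy k l len unfolding greedy_def by auto
      show "x \<in> ?T"
      proof (cases "k = m")
        case True
        then show ?thesis using step m(2) k l by auto
      next
        case False
        then show ?thesis using step subset[OF k(1)] nth_T[of "Suc k"] k(1) by auto
      qed
    qed
    moreover have T: "?T \<subseteq> {..<n}" using c(2) set_take_subset by metis
    \<comment> \<open>An injective map of a finite set into itself is onto; so, by injectivity
      again, no vertex outside \<open>?T\<close> is mapped into it.\<close>
    ultimately have image: "\<pi> ` ?T = ?T"
      using endo_inj_surj[of ?T \<pi>] inj_on_subset[OF \<pi>(1)] by auto
    have new: "c ! Suc m \<notin> ?T"
      using c(1) l len by (auto simp: in_set_conv_nth nth_eq_iff_index_eq)
    have "\<pi> (c ! Suc m) \<notin> ?T"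
    proof
      assume "\<pi> (c ! Suc m) \<in> ?T"
      then obtain x where "x \<in> ?T" "\<pi> (c ! Suc m) = \<pi> x" using image by blast
      then have "c ! Suc m = x" using \<pi>(1) nth[OF l] T by (auto dest: inj_onD)
      then show False using new \<open>x \<in> ?T\<close> by simp
    qed
    moreover have "\<pi> (c ! Suc m) \<noteq> c ! Suc m" using \<pi>(3) nth[OF l] by simp
    moreover have take: "take (Suc (Suc m)) c = take (Suc m) c @ [c ! Suc m]"
      using l len by (simp add: take_Suc_conv_app_nth)
    ultimately have no: "\<pi> (c ! Suc m) \<notin> set (take (Suc (Suc m)) c)" by simp
    \<comment> \<open>The tour goes on after the new entry: otherwise every vertex would be visited,
      also the image of \<open>c ! Suc m\<close>.\<close>
    have "Suc (Suc m) < n"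
    proof (rule ccontr)
      assume "\<not> Suc (Suc m) < n"
      then have "take (Suc (Suc m)) c = c" using len by simp
      then show False using no c(2) \<pi>(2)[OF nth[OF l]] by simp
    qed
    then have "c ! Suc (Suc m) = \<pi> (c ! Suc m)"
      using greedy no len unfolding greedy_def by blast
    then show ?thesis using l \<open>Suc (Suc m) < n\<close> by simp
  qed
qed

text \<open>An edge of the tour outside \<open>F\<close> departs from \<pi>. By
  \<open>greedy_follows\<close> two such edges are never consecutive, so if they meet, they agree in
  their first or in their second ends and hence are equal.\<close>

lemma successor_edges_matching:
  assumes greedy: "greedy \<pi> c" and c: "distinct c" "set c = {..<n}"
    and \<pi>: "inj_on \<pi> {..<n}" "\<And>i. i < n \<Longrightarrow> \<pi> i < n" "\<And>i. i < n \<Longrightarrow> \<pi> i \<noteq> i"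
      "\<And>i. i < n \<Longrightarrow> {i, \<pi> i} \<in> F"
    and e: "e \<in> successor_edges c - F" "v \<in> e" and e': "e' \<in> successor_edges c - F" "v \<in> e'"
  shows "e = e'"
proof -
  have len: "length c = n" using distinct_card[OF c(1)] c(2) by simp
  have nth: "c ! l < n" if "l < n" for l using c(2) len that nth_mem[of l c] by auto
  have bad: "\<exists>l < n. f = {c ! l, c ! (Suc l mod n)} \<and> c ! (Suc l mod n) \<noteq> \<pi> (c ! l)"
    if "f \<in> successor_edges c - F" for f
    using that \<pi>(4)[OF nth] len by (auto simp: successor_edges_def)
  obtain l m where l: "l < n" "e = {c ! l, c ! (Suc l mod n)}" "c ! (Suc l mod n) \<noteq> \<pi> (c ! l)"
    and m: "m < n" "e' = {c ! m, c ! (Suc m mod n)}" "c ! (Suc m mod n) \<noteq> \<pi> (c ! m)"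
    using bad[OF e(1)] bad[OF e'(1)] by blast
  have eq: "c ! i = c ! j \<longleftrightarrow> i = j" if "i < n" "j < n" for i j
    using nth_eq_iff_index_eq[OF c(1)] len that by simp
  have mod: "Suc i mod n < n" if "i < n" for i using that by simp
  have "Suc i mod n \<noteq> j"
    if "i < n" "c ! (Suc i mod n) \<noteq> \<pi> (c ! i)" "c ! (Suc j mod n) \<noteq> \<pi> (c ! j)" for i j
    using greedy_follows[OF greedy c \<pi>(1-3) that(1,2)] that(3) by auto
  then have "c ! (Suc l mod n) \<noteq> c ! m" "c ! (Suc m mod n) \<noteq> c ! l"
    using l m eq mod by simp_all
  then have "c ! l = c ! m \<or> c ! (Suc l mod n) = c ! (Suc m mod n)"
    using e(2) e'(2) l(2) m(2) by auto
  then have "l = m"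
    using eq[OF l(1) m(1)] eq[OF mod[OF l(1)] mod[OF m(1)]] Suc_mod_inj[OF l(1) m(1)] by blast
  then show ?thesis using l m by simp
qed

section \<open>Encodings, distance and the correctness of the output\<close>

lemma enc_graph_eq:
  "verts G = {..<n} \<Longrightarrow> enc_graph G = enc_unary n @ enc_matrix n (\<lambda>u v. {u, v} \<in> edges G)"
  by (simp add: enc_graph_def enc_matrix_def)

lemma dist_Delta_le_1:
  assumes "verts G = V" "verts H = V"
    and "\<And>v e e'. e \<in> (edges G - edges H) \<union> (edges H - edges G) \<Longrightarrow>
      e' \<in> (edges G - edges H) \<union> (edges H - edges G) \<Longrightarrow> v \<in> e \<Longrightarrow> v \<in> e' \<Longrightarrow> e = e'"
  shows "dist_Delta G H \<le> 1"
proof -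
  let ?D = "\<lparr>verts = V, edges = (edges G - edges H) \<union> (edges H - edges G)\<rparr>"
  have deg: "graph_degree ?D v \<le> 1" for v
  proof -
    let ?S = "{e \<in> edges ?D. v \<in> e}"
    have "e = e'" if "e \<in> ?S" "e' \<in> ?S" for e e'
      using that assms(3)[of e e' v] by simp
    then have "?S = {} \<or> (\<exists>e. ?S = {e})" by blast
    then have "card ?S \<le> 1" by (elim disjE exE) (simp_all only: card.empty card_insert_disjoint, auto)
    then show ?thesis by (simp add: graph_degree_def)
  qed
  have sub: "insert 0 (graph_degree ?D ` verts ?D) \<subseteq> {..1}"
    using deg by blast
  then have "finite (insert 0 (graph_degree ?D ` verts ?D))"
    by (rule finite_subset) simp
  then have "max_degree ?D \<le> 1"
    unfolding max_degree_def using sub by (intro Max.boundedI) blast+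
  then have "of_nat (max_degree ?D) \<le> (of_nat 1 :: ennreal)" by (rule of_nat_mono)
  then show ?thesis using assms(1,2) by (simp add: dist_Delta_def)
qed

lemma dist_Delta_self: "dist_Delta G G \<le> 1"
  by (rule dist_Delta_le_1[of _ "verts G"]) auto

text \<open>The encoded pair of the empty graph, whose unary size is a single \<open>False\<close>
  and whose matrix is empty, and nil.\<close>

definition output_without_vertices :: "bool list" where
  "output_without_vertices = True # double [False] @ [False, True] @ [False]"

lemma enc_option_pair:
  "enc_option (enc_pair enc_graph (enc_option enc_cycle)) (Some (J, A)) =
    True # double (enc_graph J) @ [False, True] @ enc_option enc_cycle A"
  by simp

text \<open>Either \<open>J\<close> is G itself with nil, or \<open>J\<close> is G with all edges of
  the tour. Most of these may be in G already; the distance counts only the others.\<close>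

lemma program_answers:
  assumes G: "G \<in> input_graphs" "verts G = {..<n}"
  defines "y \<equiv> if n = 0 then output_without_vertices
    else snd (run n program (\<lambda>_. 0) (initial_store n (\<lambda>u v. {u, v} \<in> edges G), []))"
  shows "\<exists>J A. J \<in> input_graphs \<and> dist_Delta G J \<le> 1 \<and> A \<in> answers Hamiltonian_Cycle J \<and>
    y = True # double (enc_graph J) @ [False, True] @ enc_option enc_cycle A"
proof -
  let ?E = "\<lambda>u v. {u, v} \<in> edges G"
  have edge: "e \<subseteq> {..<n} \<and> card e = 2" if "e \<in> edges G" for e
    using G that by (auto simp: input_graphs_def simple_graph_def)
  have nil: "None \<in> answers Hamiltonian_Cycle G" if "n < 3 \<or> (\<nexists>\<pi>. permutes_along n ?E \<pi>)"
  proof -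
    have "\<not> hamiltonian_cycle G c" for c
      using hamiltonian_permutes_along[OF _ G(2), of c] that by auto
    then show ?thesis by (simp add: answers_def Hamiltonian_Cycle_def)
  qed
  consider (nil) "n < 3 \<or> (\<nexists>\<pi>. permutes_along n ?E \<pi>)"
      "y = True # double (enc_unary n @ enc_matrix n ?E) @ [False, True] @ [False]"
    | (tour) \<pi> c where "3 \<le> n" "permutes_along n ?E \<pi>" "distinct c" "set c = {..<n}" "greedy \<pi> c"
      "y = True # double (enc_unary n @ enc_matrix n (\<lambda>u v. ?E u v \<or> linked c u v)) @
        [False, True] @ True # enc_cycle c"
  proof (cases "n = 0")
    case True
    then have "y = True # double (enc_unary n @ enc_matrix n ?E) @ [False, True] @ [False]"
      by (simp add: y_def output_without_vertices_def enc_unary_def enc_matrix_def)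
    then show thesis using True nil by (intro that(1)) auto
  next
    case False
    then show thesis using run_program[of n ?E] that unfolding y_def by auto
  qed
  then show ?thesis
  proof cases
    case nil
    then show ?thesis
      using G \<open>_ \<Longrightarrow> None \<in> answers Hamiltonian_Cycle G\<close> dist_Delta_self enc_graph_eq[OF G(2)]
      by (intro exI[of _ G] exI[of _ None]) simp
  next
    case (tour \<pi> c)
    have len: "length c = n" using distinct_card[OF tour(3)] tour(4) by simp
    then have ne: "c \<noteq> []" using tour(1) by auto
    define J where "J = \<lparr>verts = {..<n}, edges = edges G \<union> successor_edges c\<rparr>"
    have \<pi>: "inj_on \<pi> {..<n}" "\<And>i. i < n \<Longrightarrow> \<pi> i < n" "\<And>i. i < n \<Longrightarrow> {i, \<pi> i} \<in> edges G"
      using tour(2) by (auto simp: permutes_along_def)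
    \<comment> \<open>A fixed point would be a loop, but edges have two ends.\<close>
    have fixfree: "\<pi> i \<noteq> i" if "i < n" for i
      using edge[OF \<pi>(3)[OF that]] by auto
    have succ: "e \<subseteq> {..<n} \<and> card e = 2" if e: "e \<in> successor_edges c" for e
    proof -
      obtain l where l: "l < n" "e = {c ! l, c ! (Suc l mod n)}"
        using e len by (auto simp: successor_edges_def)
      \<comment> \<open>Cyclically adjacent positions differ as n is above 1, so \<open>J\<close>
        gets no loops and remains a simple graph.\<close>
      have "Suc l mod n \<noteq> l" using l(1) tour(1) by (auto simp: mod_Suc)
      then have "c ! l \<noteq> c ! (Suc l mod n)"
        using nth_eq_iff_index_eq[OF tour(3)] len l(1) by simp
      moreover have "c ! l \<in> set c" "c ! (Suc l mod n) \<in> set c"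
        using len l(1) by (auto intro: nth_mem)
      ultimately show ?thesis using tour(4) l(2) by simp
    qed
    have "J \<in> input_graphs"
      using edge succ by (auto simp: input_graphs_def simple_graph_def J_def)
    moreover have "dist_Delta G J \<le> 1"
    proof (rule dist_Delta_le_1[OF G(2)])
      fix v e e'
      assume "e \<in> (edges G - edges J) \<union> (edges J - edges G)"
        "e' \<in> (edges G - edges J) \<union> (edges J - edges G)" "v \<in> e" "v \<in> e'"
      then show "e = e'"
        using successor_edges_matching[OF tour(5,3,4) \<pi>(1,2) fixfree \<pi>(3), of e v e']
        by (auto simp: J_def)
    qed (simp add: J_def)
    moreover have "Some c \<in> answers Hamiltonian_Cycle J"
    proof -
      have "hamiltonian_cycle J c"
        using tour(1,3,4) len by (auto simp: hamiltonian_cycle_def J_def successor_edges_def)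
      then show ?thesis by (auto simp: answers_def Hamiltonian_Cycle_def)
    qed
    moreover have "enc_graph J = enc_unary n @ enc_matrix n (\<lambda>u v. ?E u v \<or> linked c u v)"
      using enc_graph_eq[of J n] linked_iff[OF ne] by (simp add: J_def)
    ultimately show ?thesis using tour(6)
      by (intro exI[of _ J] exI[of _ "Some c"]) simp
  qed
qed

theorem theorem6: "Rel Hamiltonian_Cycle dist_Delta (\<lambda>_. 1) \<in> FP"
proof -
  let ?P = "Rel Hamiltonian_Cycle dist_Delta (\<lambda>_. 1)"
  let ?bs = output_without_vertices
  let ?M = "machine ntapes nsymbols (whole ?bs program)"
  let ?p = "time program + [:2 * length ?bs + 300, 100:]"
  have "\<exists>A \<in> answers ?P G. tm_computes_within ?M (enc_input ?P G) (poly ?p (input_size ?P G))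
      (enc_option (enc_solution ?P) A)" if "G \<in> inputs ?P" for G
  proof -
    have G: "G \<in> input_graphs" using that by (simp add: Rel_def Hamiltonian_Cycle_def)
    then obtain n where n: "verts G = {..<n}" by (auto simp: input_graphs_def)
    obtain J A where JA: "J \<in> input_graphs" "dist_Delta G J \<le> 1" "A \<in> answers Hamiltonian_Cycle J"
      "(if n = 0 then ?bs else snd (run n program (\<lambda>_. 0) (initial_store n (\<lambda>u v. {u, v} \<in> edges G), [])))
        = True # double (enc_graph J) @ [False, True] @ enc_option enc_cycle A"
      using program_answers[OF G n] by blast
    have "(J, A) \<in> solutions ?P G"
      using JA(1-3) by (simp add: Rel_def Hamiltonian_Cycle_def)
    then have "Some (J, A) \<in> answers ?P G" by (auto simp: answers_def)
    moreover have "enc_input ?P G = enc_unary n @ enc_matrix n (\<lambda>u v. {u, v} \<in> edges G)"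
      using enc_graph_eq[OF n] by (simp add: Rel_def Hamiltonian_Cycle_def)
    moreover have "enc_solution ?P = enc_pair enc_graph (enc_option enc_cycle)"
      by (simp add: Rel_def Hamiltonian_Cycle_def)
    ultimately show ?thesis
      using whole_computes[OF wf_program refl, of ?bs n "\<lambda>u v. {u, v} \<in> edges G"] JA(4)
      unfolding input_size_def by (intro bexI[of _ "Some (J, A)"]) (simp_all only: enc_option_pair)
  qed
  moreover have "wf_tm ?M"
    by (rule wf_machine) (use uses_within_whole[OF wf_program] in auto)
  ultimately show ?thesis unfolding FP_def by blast
qed

end
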